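(* Consider a spectral genus one flow family of constant mean curvature (cmc) tori in $\mathbb{S}^3$ whose endpoints are the flat cmc tori with triples $(\ell_0,\ell_1,\ell_2)$ and $(\ell_1+\ell_2-\ell_0,\ell_1,\ell_2)$. The family (including its endpoints) contains exactly one minimal torus if $$(\ell_1^2+\ell_2^2)^{1/2}\ \ge\ \sqrt2\,\max\{\ell_0,\ \ell_1+\ell_2-\ell_0\},$$ and contains no minimal tori otherwise.
   Context: Spectral genus one cmc surfaces. Let $q\in[-1,1]\setminus\{0\}$ and let $\lambda_j=e^{2i\theta_j}$ ($j=1,2$) be two distinct points of $\mathbb{S}^1$ (sym points). Put $\varphi=\theta_1-\theta_2$, $k=\cos(\theta_1+\theta_2)$, $h=\cos(\theta_1-\theta_2)$, and let $v=\mathrm{dn}(y,1-q^2)$ (Jacobi function with parameter $1-q^2$). The associated equivariant cmc surface is the immersion $f:\mathbb{R}^2\to\mathbb{S}^3$, unique up to isometry, with induced metric $\sin^2\varphi\,v^2(dx^2+dy^2)$ and second fundamental form $H\sin^2\varphi\,v^2(dx^2+dy^2)+\mathrm{Re}\left(Q\,(dx+i\,dy)^2\right)$, with mean curvature $H=\cot\varphi$ (with sign convention $0<\varphi<\pi$: $H=h/\sqrt{1-h^2}$) and $Q=\frac{i}{2}q(\lambda_2^{-1}-\lambda_1^{-1})$. It is minimal iff $H=0$, i.e. $h=0$. It is rotational iff $\lambda_2=\lambda_1^{-1}$, i.e. $k^2=1$. For $q=\pm1$ it is flat; for $0<|q|<1$ it has spectral genus one. A cmc torus is such a surface modulo a lattice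 of periods. Flow families. With $K'=K(\sqrt{1-q^2})$, $E'=E(\sqrt{1-q^2})$ the complete elliptic integrals of the first and second kind (of modulus $\sqrt{1-q^2}$), consider maximal integral curves with $0<|q|<1$, consisting of tori, of $\dot q=q(E'k-qK'h)$, $\dot k=\frac{1-k^2}{1-q^2}((1+q^2)E'-2q^2K')$, $\dot h=q\frac{1-h^2}{1-q^2}(2E'-(1+q^2)K')$. A non-rotational integral curve ($k^2<1$) has two endpoints, both with $|q|=1$, which are flat cmc tori; completed by these endpoints it is a flow family. A rotational integral curve ($k^2=1$) has one endpoint with $|q|=1$, a flat cmc torus with triple $(\ell_0,0,\ell_2)$, while as $q\to0$ it converges to a sphere bouquet, i.e. a necklace of $\ell_2$ successively tangent round spheres of equal radius centred on a common geodesic. The rotational curves with flat endpoints $(\ell_0,0,\ell_2)$ and $(\ell_2-\ell_0,0,\ell_2)$ converge to the same sphere bouquet as $q\to 0$; in the rotational case the flow family is obtained by gluing these two curves together along this sphere bouquet, and its endpoints are these two flat cmc tori. Triples of flat tori. For a flat torus at $q=\pm1$ with sym points $\lambda_1,\lambda_2$, put $\lambda_0=\mathrm{sign}(q)$, $m=(\lambda_0^{1/2},\lambda_1^{1/2},\lambda_2^{1/2})$, let $(s_0,s_1,s_2)$ be an integral real multiple of the real vector $i\,m\times\bar m$ with $\gcd(s_0,s_1+s_2,s_1-s_2)=2$, and set $(\ell_0,\ell_1,\ell_2)=\frac12(|s_0|,\min|s_1\pm s_2|,\max|s_1\pm s_2|)$. These are integers with $0\le\ell_1<\ell_0<\ell_2$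 and $\gcd(\ell_0,\ell_1,\ell_2)=1$; $\ell_1=0$ exactly in the rotational case.
   Formalization: For the triple (1,0,2) the only minimal member of the family is the sphere bouquet, which is not a torus; there the theorem claims only exactly one minimal member with the bouquet counted, while for all other triples it claims exactly one minimal torus. *)

theory Defs
  imports "HOL-Analysis.Analysis"
begin

section \<open>Elliptic integrals and the Jacobi function dn\<close>

text \<open>The argument of the complete integrals is the modulus; the argument \<open>m\<close> of
  \<open>jacobi_am\<close> and \<open>jacobi_dn\<close> is the parameter (square of the modulus).\<close>

definition ellK :: "real \<Rightarrow> real" where
  "ellK \<kappa> = integral {0..pi/2} (\<lambda>t. 1 / sqrt (1 - \<kappa>\<^sup>2 * (sin t)\<^sup>2))"

definition ellE :: "real \<Rightarrow> real" where
  "ellE \<kappa> = integral {0..pi/2} (\<lambda>t. sqrt (1 - \<kappa>\<^sup>2 * (sin t)\<^sup>2))"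

definition jacobi_am :: "real \<Rightarrow> real \<Rightarrow> real" where
  "jacobi_am u m = (THE \<phi>. u = (LBINT t=0..\<phi>. 1 / sqrt (1 - m * (sin t)\<^sup>2)))"

definition jacobi_dn :: "real \<Rightarrow> real \<Rightarrow> real" where
  "jacobi_dn u m = sqrt (1 - m * (sin (jacobi_am u m))\<^sup>2)"


section \<open>Equivariant cmc surfaces and tori\<close>

text \<open>\<open>(q, k, h)\<close>, where the sym points are \<open>\<lambda>\<^sub>j = exp (2 i \<theta>\<^sub>j)\<close> and
  \<open>k = cos (\<theta>\<^sub>1 + \<theta>\<^sub>2)\<close>, \<open>h = cos (\<theta>\<^sub>1 - \<theta>\<^sub>2)\<close>.\<close>

type_synonym cmc_data = "real \<times> real \<times> real"

text \<open>Given \<open>k\<close> and \<open>h\<close>, the angles are determined up to a common shift by \<open>\<pi>\<close>, which fixes the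
  sym points, and up to \<open>(\<theta>\<^sub>1, \<theta>\<^sub>2) \<mapsto> (-\<theta>\<^sub>2, -\<theta>\<^sub>1)\<close>, which replaces the surface by
  its reparametrization under \<open>x \<mapsto> -x\<close>. The sym points are distinct because
  \<open>0 < \<theta>\<^sub>1 - \<theta>\<^sub>2 < \<pi>\<close>.\<close>

definition sym_angles :: "real \<Rightarrow> real \<Rightarrow> real \<Rightarrow> real \<Rightarrow> bool" where
  "sym_angles k h \<theta>1 \<theta>2 \<longleftrightarrow>
     0 < \<theta>1 - \<theta>2 \<and> \<theta>1 - \<theta>2 < pi \<and> k = cos (\<theta>1 + \<theta>2) \<and> h = cos (\<theta>1 - \<theta>2)"

definition hopf_coeff :: "real \<Rightarrow> real \<Rightarrow> real \<Rightarrow> complex" where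
  "hopf_coeff q \<theta>1 \<theta>2 =
     \<i> / 2 * complex_of_real q * (inverse (cis (2 * \<theta>2)) - inverse (cis (2 * \<theta>1)))"

text \<open>\<open>f\<close> is an immersion of class \<open>C\<^sup>2\<close> into the unit sphere of \<open>\<real>\<^sup>4\<close> with unit normal \<open>N\<close>,
  induced metric \<open>g (dx\<^sup>2 + dy\<^sup>2)\<close>, and second fundamental form
  \<open>H g (dx\<^sup>2 + dy\<^sup>2) + Re (Q (dx + i dy)\<^sup>2)\<close>, where
  \<open>Re (Q (dx + i dy)\<^sup>2) = Re Q (dx\<^sup>2 - dy\<^sup>2) - 2 Im Q dx dy\<close>.
  Class \<open>C\<^sup>2\<close> is no loss of generality: as the two forms are real analytic,
  the Gauss-Weingarten equations make \<open>f\<close> smooth.\<close>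

definition equivariant_cmc_immersion ::
    "real \<Rightarrow> real \<Rightarrow> real \<Rightarrow> (real \<Rightarrow> real \<Rightarrow> real ^ 4) \<Rightarrow> bool" where
  "equivariant_cmc_immersion q \<theta>1 \<theta>2 f \<longleftrightarrow>
     (\<exists>fx fy fxx fxy fyy N :: real \<Rightarrow> real \<Rightarrow> real ^ 4.
        continuous_on UNIV (\<lambda>(x, y). fxx x y) \<and>
        continuous_on UNIV (\<lambda>(x, y). fxy x y) \<and>
        continuous_on UNIV (\<lambda>(x, y). fyy x y) \<and>
        continuous_on UNIV (\<lambda>(x, y). N x y) \<and>
        (\<forall>x y.
           ((\<lambda>x. f x y) has_vector_derivative fx x y) (at x) \<and>
           ((\<lambda>y. f x y) has_vector_derivative fy x y) (at y) \<and>
           ((\<lambda>x. fx x y) has_vector_derivative fxx x y) (at x) \<and>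
           ((\<lambda>y. fx x y) has_vector_derivative fxy x y) (at y) \<and>
           ((\<lambda>x. fy x y) has_vector_derivative fxy x y) (at x) \<and>
           ((\<lambda>y. fy x y) has_vector_derivative fyy x y) (at y) \<and>
           norm (f x y) = 1 \<and>
           norm (N x y) = 1 \<and> N x y \<bullet> f x y = 0 \<and>
           N x y \<bullet> fx x y = 0 \<and> N x y \<bullet> fy x y = 0 \<and>
           (let g = (sin (\<theta>1 - \<theta>2))\<^sup>2 * (jacobi_dn y (1 - q\<^sup>2))\<^sup>2;
                H = cot (\<theta>1 - \<theta>2);
                Q = hopf_coeff q \<theta>1 \<theta>2
            in fx x y \<bullet> fx x y = g \<and> fx x y \<bullet> fy x y = 0 \<and> fy x y \<bullet> fy x y = g \<and>
               fxx x y \<bullet> N x y = H * g + Re Q \<and>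
               fxy x y \<bullet> N x y = - Im Q \<and>
               fyy x y \<bullet> N x y = H * g - Re Q)))"

definition doubly_periodic :: "(real \<Rightarrow> real \<Rightarrow> 'a) \<Rightarrow> bool" where
  "doubly_periodic f \<longleftrightarrow>
     (\<exists>a b c d :: real. a * d - b * c \<noteq> 0 \<and>
        (\<forall>x y. f (x + a) (y + b) = f x y \<and> f (x + c) (y + d) = f x y))"

definition cmc_torus :: "cmc_data \<Rightarrow> bool" where
  "cmc_torus = (\<lambda>(q, k, h).
     q \<noteq> 0 \<and> \<bar>q\<bar> \<le> 1 \<and>
     (\<exists>\<theta>1 \<theta>2 f. sym_angles k h \<theta>1 \<theta>2 \<and>
        equivariant_cmc_immersion q \<theta>1 \<theta>2 f \<and> doubly_periodic f))"

definition flat_torus :: "cmc_data \<Rightarrow> bool" where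
  "flat_torus = (\<lambda>(q, k, h). \<bar>q\<bar> = 1 \<and> cmc_torus (q, k, h))"

text \<open>\<open>cot (\<theta>\<^sub>1 - \<theta>\<^sub>2)\<close> in terms of \<open>h\<close>; meaningful only for \<open>h\<^sup>2 < 1\<close>,
  which holds at all members of a flow family.\<close>

definition mean_curvature :: "cmc_data \<Rightarrow> real" where
  "mean_curvature = (\<lambda>(q, k, h). h / sqrt (1 - h\<^sup>2))"

definition minimal :: "cmc_data \<Rightarrow> bool" where
  "minimal p \<longleftrightarrow> mean_curvature p = 0"


section \<open>Triples of flat tori\<close>

text \<open>The \<open>m\<^sub>j\<close> are arbitrary square roots of the \<open>\<lambda>\<^sub>j\<close>; changing them only changes signs
  of the \<open>s\<^sub>j\<close> in such a way that the triple is unaffected.\<close>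

definition flat_triple :: "cmc_data \<Rightarrow> int \<times> int \<times> int \<Rightarrow> bool" where
  "flat_triple = (\<lambda>(q, k, h) (l0, l1, l2).
     \<bar>q\<bar> = 1 \<and>
     (\<exists>\<theta>1 \<theta>2 m0 m1 m2 (s0::int) (s1::int) (s2::int) c.
        sym_angles k h \<theta>1 \<theta>2 \<and>
        m0\<^sup>2 = complex_of_real (sgn q) \<and> m1\<^sup>2 = cis (2 * \<theta>1) \<and> m2\<^sup>2 = cis (2 * \<theta>2) \<and>
        of_int s0 = complex_of_real c * (\<i> * (m1 * cnj m2 - m2 * cnj m1)) \<and>
        of_int s1 = complex_of_real c * (\<i> * (m2 * cnj m0 - m0 * cnj m2)) \<and>
        of_int s2 = complex_of_real c * (\<i> * (m0 * cnj m1 - m1 * cnj m0)) \<and>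
        gcd s0 (gcd (s1 + s2) (s1 - s2)) = 2 \<and>
        2 * l0 = \<bar>s0\<bar> \<and>
        2 * l1 = min \<bar>s1 + s2\<bar> \<bar>s1 - s2\<bar> \<and>
        2 * l2 = max \<bar>s1 + s2\<bar> \<bar>s1 - s2\<bar>))"


section \<open>Flow families\<close>

definition flow_field :: "cmc_data \<Rightarrow> cmc_data" where
  "flow_field = (\<lambda>(q, k, h).
     let K' = ellK (sqrt (1 - q\<^sup>2)); E' = ellE (sqrt (1 - q\<^sup>2))
     in (q * (E' * k - q * K' * h),
         (1 - k\<^sup>2) / (1 - q\<^sup>2) * ((1 + q\<^sup>2) * E' - 2 * q\<^sup>2 * K'),
         q * (1 - h\<^sup>2) / (1 - q\<^sup>2) * (2 * E' - (1 + q\<^sup>2) * K')))"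

definition genus_one_data :: "cmc_data set" where
  "genus_one_data = {(q, k, h). 0 < \<bar>q\<bar> \<and> \<bar>q\<bar> < 1 \<and> k\<^sup>2 \<le> 1 \<and> h\<^sup>2 < 1}"

definition integral_curve :: "ereal \<Rightarrow> ereal \<Rightarrow> (real \<Rightarrow> cmc_data) \<Rightarrow> bool" where
  "integral_curve a b \<gamma> \<longleftrightarrow> a < b \<and>
     (\<forall>t\<in>einterval a b. \<gamma> t \<in> genus_one_data \<and>
        (\<gamma> has_vector_derivative flow_field (\<gamma> t)) (at t))"

definition maximal_integral_curve :: "ereal \<Rightarrow> ereal \<Rightarrow> (real \<Rightarrow> cmc_data) \<Rightarrow> bool" where
  "maximal_integral_curve a b \<gamma> \<longleftrightarrow> integral_curve a b \<gamma> \<and>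
     (\<forall>a' b' \<gamma>'. integral_curve a' b' \<gamma>' \<and> einterval a b \<subseteq> einterval a' b' \<and>
        (\<forall>t\<in>einterval a b. \<gamma>' t = \<gamma> t) \<longrightarrow> einterval a' b' = einterval a b)"

definition curve_of_tori :: "ereal \<Rightarrow> ereal \<Rightarrow> (real \<Rightarrow> cmc_data) \<Rightarrow> bool" where
  "curve_of_tori a b \<gamma> \<longleftrightarrow> maximal_integral_curve a b \<gamma> \<and> (\<forall>t\<in>einterval a b. cmc_torus (\<gamma> t))"

definition has_ends ::
    "ereal \<Rightarrow> ereal \<Rightarrow> (real \<Rightarrow> cmc_data) \<Rightarrow> cmc_data \<Rightarrow> cmc_data \<Rightarrow> bool" where
  "has_ends a b \<gamma> P P' \<longleftrightarrow>
     ((\<gamma> \<circ> real_of_ereal) \<longlongrightarrow> P) (at_right a) \<and> ((\<gamma> \<circ> real_of_ereal) \<longlongrightarrow> P') (at_left b)"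

definition rotational :: "cmc_data \<Rightarrow> bool" where
  "rotational = (\<lambda>(q, k, h). k\<^sup>2 = 1)"

definition nonrotational_flow_family :: "cmc_data set \<Rightarrow> cmc_data \<Rightarrow> cmc_data \<Rightarrow> bool" where
  "nonrotational_flow_family F P P' \<longleftrightarrow>
     (\<exists>a b \<gamma>. curve_of_tori a b \<gamma> \<and> (\<forall>t\<in>einterval a b. \<not> rotational (\<gamma> t)) \<and>
        has_ends a b \<gamma> P P' \<and> flat_torus P \<and> flat_torus P' \<and>
        F = \<gamma> ` einterval a b \<union> {P, P'})"

text \<open>A sphere bouquet is the limit \<open>q \<rightarrow> 0\<close> of rotational data. It consists of round spheres of
  radius \<open>arccos h\<close>, whose mean curvature is \<open>h / sqrt (1 - h\<^sup>2)\<close>. The number of spheres is the last entry of the triple at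
  the flat end of the curve.\<close>

definition sphere_bouquet :: "cmc_data \<Rightarrow> bool" where
  "sphere_bouquet = (\<lambda>(q, k, h). q = 0 \<and> k\<^sup>2 = 1 \<and> h\<^sup>2 < 1)"

text \<open>\<open>C\<close> is the trace of a rotational integral curve joining the bouquet \<open>S\<close> and the flat
  torus \<open>P\<close>; depending on the sign of \<open>q * k\<close> the flow runs towards or away from \<open>S\<close>.\<close>

definition rotational_arc :: "cmc_data set \<Rightarrow> cmc_data \<Rightarrow> cmc_data \<Rightarrow> bool" where
  "rotational_arc C S P \<longleftrightarrow>
     (\<exists>a b \<gamma>. curve_of_tori a b \<gamma> \<and> (\<forall>t\<in>einterval a b. rotational (\<gamma> t)) \<and>
        (has_ends a b \<gamma> S P \<or> has_ends a b \<gamma> P S) \<and> sphere_bouquet S \<and> flat_torus P \<and>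
        C = \<gamma> ` einterval a b)"

text \<open>Two rotational curves are glued by continuing \<open>(q, k, h)\<close> through \<open>q = 0\<close>, so the two arcs
  lie on opposite sides of \<open>q = 0\<close>. This is only a normalization of the representing data: since
  \<open>(q, \<lambda>\<^sub>1, \<lambda>\<^sub>2)\<close> and \<open>(-q, -\<lambda>\<^sub>1, -\<lambda>\<^sub>2)\<close> give the same surface, \<open>(q, k, h)\<close> and \<open>(-q, -k, h)\<close>
  do so too, and interchanging the sym points, i.e. reversing the normal, turns \<open>(q, k, h)\<close> into
  \<open>(q, -k, -h)\<close>.\<close>

definition rotational_flow_family :: "cmc_data set \<Rightarrow> cmc_data \<Rightarrow> cmc_data \<Rightarrow> bool" where
  "rotational_flow_family F P P' \<longleftrightarrow>
     (\<exists>S C C'. rotational_arc C S P \<and> rotational_arc C' S P' \<and> fst P * fst P' < 0 \<and>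
        F = C \<union> C' \<union> {S, P, P'})"

definition flow_family :: "cmc_data set \<Rightarrow> cmc_data \<Rightarrow> cmc_data \<Rightarrow> bool" where
  "flow_family F P P' \<longleftrightarrow> nonrotational_flow_family F P P' \<or> rotational_flow_family F P P'"

end

theory Submission
  imports Defs
begin

text \<open>Write \<open>Q = \<bar>q\<bar>\<close> and \<open>w = sgn q * h\<close>. Since \<open>2E' < (1 + q\<^sup>2)K'\<close>, the function \<open>w\<close> is strictly
  decreasing along the flow, so a family contains a minimal torus iff \<open>h\<close> vanishes or changes sign
  between its ends, and then exactly one. At a flat torus \<open>l1\<^sup>2 + l2\<^sup>2 - 2 l0\<^sup>2\<close> is a positive multiple of
  \<open>h (h - q k)\<close>, and the sign of \<open>h - q k\<close> is known at each end because the flow moves away from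
  \<open>Q = 1\<close> at the lower end and towards it at the upper one. Hence the two inequalities of the
  condition say that \<open>w \<ge> 0\<close> at the first end and \<open>w \<le> 0\<close> at the second.

  In the rotational case \<open>Q K' \<le> E'\<close> makes \<open>Q\<close> monotone as well, and \<open>k * w\<close> as a function of
  \<open>Q\<close> solves a scalar equation, the same for both arcs, and decreases from the bouquet to the flat
  torus. If the bouquet itself has \<open>h = 0\<close>, both arcs solve the same initial value problem,
  so the two flat ends have opposite \<open>h\<close>, which forces \<open>l2 = 2 l0\<close> and hence the triple \<open>(1, 0, 2)\<close>.\<close>


section \<open>Complete elliptic integrals\<close>

text \<open>The radius sqrt (cos^2 t + q^2 sin^2 t) of an ellipse with semi-axes 1 and
  \<open>\<bar>q\<bar>\<close>: the integrand of \<open>E'\<close> and the reciprocal of that of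
  \<open>K'\<close>, since the complementary modulus has square 1 - q^2.\<close>

definition Delta :: "real \<Rightarrow> real \<Rightarrow> real" where
  "Delta q t = sqrt (1 - (1 - q\<^sup>2) * (sin t)\<^sup>2)"

definition K' :: "real \<Rightarrow> real" where "K' q = ellK (sqrt (1 - q\<^sup>2))"

definition E' :: "real \<Rightarrow> real" where "E' q = ellE (sqrt (1 - q\<^sup>2))"

lemma has_integral_reflect_quarter:
  fixes f :: "real \<Rightarrow> real"
  assumes "(f has_integral I) {0..pi/2}"
  shows "((\<lambda>t. f (pi/2 - t)) has_integral I) {0..pi/2}"
proof -
  have "((\<lambda>t. f (- t)) has_integral I) {- (pi/2)..0}"
    using has_integral_reflect_real[of f I "pi/2" 0] assms by simp
  then show ?thesis
    using has_integral_shift_real_ivl[of "\<lambda>t. f (- t)" I "- (pi/2)" 0 "- (pi/2)"] by simp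
qed

context
  fixes q :: real
  assumes q: "0 < \<bar>q\<bar>" "\<bar>q\<bar> \<le> 1"
begin

lemma q_sq: "0 < q\<^sup>2" "q\<^sup>2 \<le> 1"
  using q by (auto simp: abs_square_le_1)

lemma Delta_sq: "(Delta q t)\<^sup>2 = (cos t)\<^sup>2 + q\<^sup>2 * (sin t)\<^sup>2"
proof -
  have *: "1 - (1 - q\<^sup>2) * (sin t)\<^sup>2 = (cos t)\<^sup>2 + q\<^sup>2 * (sin t)\<^sup>2"
    by (simp add: cos_squared_eq algebra_simps)
  show ?thesis unfolding Delta_def * by simp
qed

lemma Delta_bounds: "\<bar>q\<bar> \<le> Delta q t" "Delta q t \<le> 1" "0 < Delta q t"
proof -
  have "(1 - q\<^sup>2) * (sin t)\<^sup>2 \<le> 1 - q\<^sup>2" "0 \<le> (1 - q\<^sup>2) * (sin t)\<^sup>2"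
    using q_sq mult_left_mono[of "(sin t)\<^sup>2" 1 "1 - q\<^sup>2"] by (auto simp: abs_square_le_1)
  then have "sqrt (q\<^sup>2) \<le> Delta q t" "Delta q t \<le> sqrt 1"
    unfolding Delta_def by (intro real_sqrt_le_mono; linarith)+
  then show "\<bar>q\<bar> \<le> Delta q t" "Delta q t \<le> 1" "0 < Delta q t" using q by auto
qed

lemma continuous_on_Delta [continuous_intros]: "continuous_on A (Delta q)"
  unfolding Delta_def by (intro continuous_intros)

lemma has_integral_E': "(Delta q has_integral E' q) {0..pi/2}"
proof -
  have "E' q = integral {0..pi/2} (Delta q)"
    unfolding E'_def ellE_def Delta_def using q_sq by simp
  then show ?thesis
    by (simp add: integrable_integral integrable_continuous_interval continuous_on_Delta)
qed

lemma has_integral_K': "((\<lambda>t. 1 / Delta q t) has_integral K' q) {0..pi/2}"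
proof -
  have "K' q = integral {0..pi/2} (\<lambda>t. 1 / Delta q t)"
    unfolding K'_def ellK_def Delta_def using q_sq by simp
  moreover have "continuous_on {0..pi/2} (\<lambda>t. 1 / Delta q t)"
    by (intro continuous_intros) (metis Delta_bounds(3) less_irrefl)
  ultimately show ?thesis
    by (simp add: integrable_integral integrable_continuous_interval)
qed

text \<open>Integrating the pointwise bounds on \<open>Delta\<close> is crude, but sharp at
  \<open>\<bar>q\<bar>\<close> = 1, the only place where values of the integrals are
  required.\<close>

lemma E'_bounds: "\<bar>q\<bar> * (pi/2) \<le> E' q" "E' q \<le> pi/2"
proof -
  have c: "((\<lambda>t. c) has_integral c * (pi/2)) {0..pi/2}" for c :: real
    using has_integral_const_real[of c 0 "pi/2"] by (simp add: mult.commute)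
  show "\<bar>q\<bar> * (pi/2) \<le> E' q"
    by (rule has_integral_le[OF c has_integral_E']) (rule Delta_bounds)
  show "E' q \<le> pi/2"
    using has_integral_le[OF has_integral_E' c[of 1]] Delta_bounds by simp
qed

lemma K'_bounds: "pi/2 \<le> K' q" "K' q \<le> (pi/2) / \<bar>q\<bar>"
proof -
  have c: "((\<lambda>t. c) has_integral c * (pi/2)) {0..pi/2}" for c :: real
    using has_integral_const_real[of c 0 "pi/2"] by (simp add: mult.commute)
  have "1 \<le> 1 / Delta q t" "1 / Delta q t \<le> 1 / \<bar>q\<bar>" for t
    using Delta_bounds[of t] q by (auto simp: field_simps)
  then show "pi/2 \<le> K' q" "K' q \<le> (pi/2) / \<bar>q\<bar>"
    using has_integral_le[OF has_integral_K' c[of "1 / \<bar>q\<bar>"]]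
      has_integral_le[OF c[of 1] has_integral_K'] by simp_all
qed

lemma E'_pos: "0 < E' q"
  using E'_bounds(1) q by (smt (verit) mult_pos_pos pi_half_gt_zero)

lemma K'_pos: "0 < K' q"
  using K'_bounds(1) pi_half_gt_zero by linarith

section \<open>Comparison of \<open>E'\<close> and \<open>K'\<close> by symmetrization\<close>

text \<open>The square of the product exceeds q^2 by sin^2 t cos^2 t (1 - q^2)^2. This is the
  pointwise form of the comparison of \<open>E'\<close> with
  \<open>\<bar>q\<bar> * K'\<close>.\<close>

lemma Delta_reflect_mult: "\<bar>q\<bar> \<le> Delta q t * Delta q (pi/2 - t)"
proof -
  have s: "(sin t)\<^sup>2 = 1 - (cos t)\<^sup>2" by (simp add: sin_squared_eq)
  have "(Delta q t * Delta q (pi/2 - t))\<^sup>2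
      = ((cos t)\<^sup>2 + q\<^sup>2 * (sin t)\<^sup>2) * ((sin t)\<^sup>2 + q\<^sup>2 * (cos t)\<^sup>2)"
    using Delta_sq[of t] Delta_sq[of "pi/2 - t"]
    by (simp add: power_mult_distrib sin_diff cos_diff)
  also have "\<dots> = q\<^sup>2 + ((cos t)\<^sup>2 * (sin t)\<^sup>2) * (1 - q\<^sup>2)\<^sup>2"
    unfolding s by algebra
  finally have "\<bar>q\<bar>\<^sup>2 \<le> (Delta q t * Delta q (pi/2 - t))\<^sup>2" by simp
  moreover have "0 \<le> Delta q t * Delta q (pi/2 - t)"
    by (intro mult_nonneg_nonneg less_imp_le Delta_bounds)
  ultimately show ?thesis by (rule power2_le_imp_le)
qed

text \<open>Averaging an integrand over \<open>t\<close> and \<open>pi/2 - t\<close> makes the next two estimates pointwise.\<close>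

lemma q_K'_le_E': "\<bar>q\<bar> * K' q \<le> E' q"
proof -
  let ?D = "Delta q" and ?R = "\<lambda>t. Delta q (pi/2 - t)"
  have "((\<lambda>t. (?D t + ?R t) - \<bar>q\<bar> * (1 / ?D t + 1 / ?R t)) has_integral
      (E' q + E' q) - \<bar>q\<bar> * (K' q + K' q)) {0..pi/2}"
    by (intro has_integral_diff has_integral_add has_integral_mult_right has_integral_E'
        has_integral_K' has_integral_reflect_quarter[OF has_integral_E']
        has_integral_reflect_quarter[OF has_integral_K'])
  moreover have "0 \<le> (?D t + ?R t) - \<bar>q\<bar> * (1 / ?D t + 1 / ?R t)" for t
  proof -
    have pos: "0 < ?D t" "0 < ?R t" by (rule Delta_bounds)+
    then have "(?D t + ?R t) - \<bar>q\<bar> * (1 / ?D t + 1 / ?R t)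
        = (?D t + ?R t) * (1 - \<bar>q\<bar> / (?D t * ?R t))"
      by (simp add: field_simps)
    moreover have "\<bar>q\<bar> / (?D t * ?R t) \<le> 1"
      using pos Delta_reflect_mult[of t] by simp
    ultimately show ?thesis using pos by simp
  qed
  ultimately have "0 \<le> (E' q + E' q) - \<bar>q\<bar> * (K' q + K' q)"
    by (rule has_integral_nonneg)
  then show ?thesis by (simp add: algebra_simps)
qed

lemma two_E'_less:
  assumes q1: "\<bar>q\<bar> < 1"
  shows "2 * E' q < (1 + q\<^sup>2) * K' q"
proof -
  let ?D = "Delta q" and ?R = "\<lambda>t. Delta q (pi/2 - t)"
  let ?c = "1 + q\<^sup>2"
  let ?f = "\<lambda>t. ?c * (1 / ?D t + 1 / ?R t) - 2 * (?D t + ?R t)"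
  let ?I = "?c * (K' q + K' q) - 2 * (E' q + E' q)"
  have q21: "q\<^sup>2 < 1" using q1 by (simp add: abs_square_less_1)
  have I: "(?f has_integral ?I) {0..pi/2}"
    by (intro has_integral_diff has_integral_add has_integral_mult_right has_integral_E'
        has_integral_K' has_integral_reflect_quarter[OF has_integral_E']
        has_integral_reflect_quarter[OF has_integral_K'])
  \<comment> \<open>The squares of \<open>?D t\<close> and \<open>?R t\<close> add up to
    \<open>?c\<close>, which completes the square and shows the averaged integrand to be
    nonnegative.\<close>
  have f: "?f t = (?D t + ?R t) * (?D t - ?R t)\<^sup>2 / (?D t * ?R t)" for t
  proof -
    have pos: "0 < ?D t" "0 < ?R t" by (rule Delta_bounds)+
    have "?c = (?D t)\<^sup>2 + (?R t)\<^sup>2"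
      unfolding Delta_sq by (simp add: sin_diff cos_diff cos_squared_eq algebra_simps)
    then show ?thesis using pos by (simp add: field_simps power2_eq_square)
  qed
  have nn: "0 \<le> ?f t" for t
    unfolding f using Delta_bounds(3)[of t] Delta_bounds(3)[of "pi/2 - t"] by simp
  have "continuous_on {0..pi/2} ?R" 
    by (intro continuous_on_compose2[OF continuous_on_Delta[of UNIV]] continuous_intros) auto
  then have cont: "continuous_on {0..pi/2} ?f"
    by (intro continuous_intros) (metis Delta_bounds(3) less_irrefl)+
  \<comment> \<open>Strictness: at 0 the two radii are 1 and \<open>\<bar>q\<bar>\<close> < 1, so
    the integrand is positive there, and a continuous nonnegative function with zero integral would
    vanish identically.\<close>
  have "?D 0 = 1" "?R 0 = \<bar>q\<bar>" by (simp_all add: Delta_def)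
  then have "0 < ?f 0" unfolding f using q q1 by simp
  moreover have "integral {0..pi/2} ?f = 0 \<longleftrightarrow> (\<forall>t\<in>{0..pi/2}. ?f t = 0)"
    by (rule integral_eq_0_iff[OF cont _ nn]) simp
  moreover have "integral {0..pi/2} ?f = ?I" using I by (rule integral_unique)
  ultimately have "?I \<noteq> 0" by force
  moreover have "0 \<le> ?I" using I nn by (rule has_integral_nonneg)
  ultimately show ?thesis by (simp add: algebra_simps)
qed

end

text \<open>Squeezed between the bounds above, both integrals approach pi/2; this gives the
  behaviour of the flow at a flat end.\<close>

lemma tendsto_E'_K':
  assumes Q: "((\<lambda>t. \<bar>q t\<bar>) \<longlongrightarrow> 1) F" and ev: "\<forall>\<^sub>F t in F. 0 < \<bar>q t\<bar> \<and> \<bar>q t\<bar> \<le> 1"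
  shows "((\<lambda>t. E' (q t)) \<longlongrightarrow> pi/2) F" "((\<lambda>t. K' (q t)) \<longlongrightarrow> pi/2) F"
proof -
  have l: "((\<lambda>t. \<bar>q t\<bar> * (pi/2)) \<longlongrightarrow> pi/2) F" "((\<lambda>t. (pi/2) / \<bar>q t\<bar>) \<longlongrightarrow> pi/2) F"
    using tendsto_mult_right[OF Q, of "pi/2"] tendsto_divide[OF tendsto_const[of "pi/2"] Q] by simp_all
  show "((\<lambda>t. E' (q t)) \<longlongrightarrow> pi/2) F"
    by (rule tendsto_sandwich[OF _ _ l(1) tendsto_const])
      (use ev in \<open>(rule eventually_mono, blast intro: E'_bounds)+\<close>)
  show "((\<lambda>t. K' (q t)) \<longlongrightarrow> pi/2) F"
    by (rule tendsto_sandwich[OF _ _ tendsto_const l(2)])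
      (use ev in \<open>(rule eventually_mono, blast intro: K'_bounds)+\<close>)
qed


section \<open>Triples of flat tori\<close>

text \<open>Passing to squares removes the choice of square roots, and the sum and product of the
  squares of \<open>l1\<close> and \<open>l2\<close> do not see which of
  \<open>\<bar>s1 + s2\<bar>\<close>, \<open>\<bar>s1 - s2\<bar>\<close> is the smaller. What
  remains depends on \<open>q\<close>, \<open>k\<close>, \<open>h\<close> and the square
  \<open>C\<close> of the scaling factor \<open>c\<close>.\<close>

lemma flat_tripleD:
  assumes "flat_triple (q, k, h) (l0, l1, l2)"
  obtains C where "0 \<le> C" "\<bar>q\<bar> = 1" "k\<^sup>2 \<le> 1" "h\<^sup>2 < 1" "0 \<le> l1" "0 \<le> l2"
    "(real_of_int l0)\<^sup>2 = C * (1 - h\<^sup>2)"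
    "(real_of_int l1)\<^sup>2 + (real_of_int l2)\<^sup>2 = 2 * C * (1 - q * k * h)"
    "(real_of_int l1)\<^sup>2 * (real_of_int l2)\<^sup>2 = C\<^sup>2 * (1 - k\<^sup>2) * (1 - h\<^sup>2)"
    "\<And>d. d dvd l0 \<Longrightarrow> d dvd l1 \<Longrightarrow> d dvd l2 \<Longrightarrow> d dvd 1"
proof -
  from assms obtain \<theta>1 \<theta>2 m0 m1 m2 and s0 s1 s2 :: int and c where
    q: "\<bar>q\<bar> = 1" and sym: "sym_angles k h \<theta>1 \<theta>2" and
    m: "m0\<^sup>2 = complex_of_real (sgn q)" "m1\<^sup>2 = cis (2 * \<theta>1)" "m2\<^sup>2 = cis (2 * \<theta>2)" and
    s: "of_int s0 = complex_of_real c * (\<i> * (m1 * cnj m2 - m2 * cnj m1))"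
      "of_int s1 = complex_of_real c * (\<i> * (m2 * cnj m0 - m0 * cnj m2))"
      "of_int s2 = complex_of_real c * (\<i> * (m0 * cnj m1 - m1 * cnj m0))" and
    g: "gcd s0 (gcd (s1 + s2) (s1 - s2)) = 2" and
    l: "2 * l0 = \<bar>s0\<bar>" "2 * l1 = min \<bar>s1 + s2\<bar> \<bar>s1 - s2\<bar>" "2 * l2 = max \<bar>s1 + s2\<bar> \<bar>s1 - s2\<bar>"
    unfolding flat_triple_def case_prod_conv by (elim conjE exE) (rule that)
  have qs: "sgn q = q" "q\<^sup>2 = 1" using q by (auto simp: sgn_real_def abs_if power2_eq_square split: if_splits)
  \<comment> \<open>For unit \<open>z\<close> and \<open>w\<close> the bracket is purely imaginary,
    and its square involves only the squares of \<open>z\<close> and \<open>w\<close>, that is, the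
    sym points and \<open>sgn q\<close>.\<close>
  have key: "(real_of_int s)\<^sup>2 = 2 * c\<^sup>2 * (1 - Re (z\<^sup>2 * cnj (w\<^sup>2)))"
    if sz: "of_int s = complex_of_real c * (\<i> * (z * cnj w - w * cnj z))"
      and z: "cmod (z\<^sup>2) = 1" and w: "cmod (w\<^sup>2) = 1" for s :: int and z w :: complex
  proof -
    have z1: "z * cnj z = 1" and w1: "w * cnj w = 1"
      using z w complex_norm_square[of z] complex_norm_square[of w] by (simp_all add: norm_power)
    have "of_int s * of_int s = - ((complex_of_real c)\<^sup>2) * (z * cnj w - w * cnj z)\<^sup>2"
      unfolding sz by (simp add: power2_eq_square algebra_simps)
    also have "(z * cnj w - w * cnj z)\<^sup>2 = z\<^sup>2 * cnj (w\<^sup>2) + cnj (z\<^sup>2 * cnj (w\<^sup>2)) - 2 * (z * cnj z) * (w * cnj w)"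
      by (simp add: power2_eq_square algebra_simps)
    also have "\<dots> = complex_of_real (2 * Re (z\<^sup>2 * cnj (w\<^sup>2)) - 2)"
      unfolding z1 w1 complex_add_cnj by simp
    finally have "Re (of_int s * of_int s :: complex) = Re (- ((complex_of_real c)\<^sup>2) * complex_of_real (2 * Re (z\<^sup>2 * cnj (w\<^sup>2)) - 2))"
      by simp
    then show ?thesis by (simp add: power2_eq_square algebra_simps)
  qed
  have nm: "cmod (m0\<^sup>2) = 1" "cmod (m1\<^sup>2) = 1" "cmod (m2\<^sup>2) = 1"
    unfolding m using q qs by simp_all
  have \<theta>: "2 * \<theta>1 = (\<theta>1 + \<theta>2) + (\<theta>1 - \<theta>2)" "2 * \<theta>2 = (\<theta>1 + \<theta>2) - (\<theta>1 - \<theta>2)" by simp_all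
  define a b where "a = \<theta>1 + \<theta>2" and "b = \<theta>1 - \<theta>2"
  have kh: "k = cos a" "h = cos b" and b: "0 < b" "b < pi"
    using sym unfolding sym_angles_def a_def b_def by auto
  have "0 < sin b" using b by (rule sin_gt_zero)
  then have h1: "h\<^sup>2 < 1" using kh(2) by (simp add: cos_squared_eq)
  have k1: "k\<^sup>2 \<le> 1" using kh(1) by (simp add: abs_square_le_1)
  have "(real_of_int s0)\<^sup>2 = 2 * c\<^sup>2 * (1 - cos (2 * b))"
    using key[OF s(1) nm(2) nm(3)] unfolding m cis_cnj cis_mult b_def by (simp add: algebra_simps)
  then have s0: "(real_of_int s0)\<^sup>2 = 4 * c\<^sup>2 * (1 - h\<^sup>2)"
    unfolding kh cos_double_cos by (simp add: algebra_simps)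
  have "(real_of_int s1)\<^sup>2 = 2 * c\<^sup>2 * (1 - q * cos (a - b))"
    using key[OF s(2) nm(3) nm(1)] unfolding m qs \<theta>(2) a_def b_def by (simp add: mult.commute)
  then have s1: "(real_of_int s1)\<^sup>2 = 2 * c\<^sup>2 * (1 - q * (k * h + sin a * sin b))"
    unfolding kh cos_diff .
  have "(real_of_int s2)\<^sup>2 = 2 * c\<^sup>2 * (1 - q * cos (a + b))"
    using key[OF s(3) nm(1) nm(2)] unfolding m qs \<theta>(1) a_def b_def by (simp add: mult.commute)
  then have s2: "(real_of_int s2)\<^sup>2 = 2 * c\<^sup>2 * (1 - q * (k * h - sin a * sin b))"
    unfolding kh cos_add .
  have ss: "(sin a)\<^sup>2 = 1 - k\<^sup>2" "(sin b)\<^sup>2 = 1 - h\<^sup>2" unfolding kh by (simp_all add: sin_squared_eq)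
  have l': "2 * real_of_int l0 = \<bar>real_of_int s0\<bar>"
    "2 * real_of_int l1 = min \<bar>real_of_int s1 + real_of_int s2\<bar> \<bar>real_of_int s1 - real_of_int s2\<bar>"
    "2 * real_of_int l2 = max \<bar>real_of_int s1 + real_of_int s2\<bar> \<bar>real_of_int s1 - real_of_int s2\<bar>"
    using l[THEN arg_cong[where f = real_of_int]] by (simp_all add: of_int_min of_int_max)
  have L0: "4 * (real_of_int l0)\<^sup>2 = (real_of_int s0)\<^sup>2"
    using arg_cong[OF l'(1), of "\<lambda>x. x\<^sup>2"] by (simp add: power_mult_distrib)
  have "(2 * real_of_int l1)\<^sup>2 + (2 * real_of_int l2)\<^sup>2
      = (real_of_int s1 + real_of_int s2)\<^sup>2 + (real_of_int s1 - real_of_int s2)\<^sup>2"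
    unfolding l' by (auto simp: min_def max_def)
  then have L12: "4 * ((real_of_int l1)\<^sup>2 + (real_of_int l2)\<^sup>2) = 2 * ((real_of_int s1)\<^sup>2 + (real_of_int s2)\<^sup>2)"
    by (simp add: power2_eq_square algebra_simps)
  have "(2 * real_of_int l1)\<^sup>2 * (2 * real_of_int l2)\<^sup>2
      = (real_of_int s1 + real_of_int s2)\<^sup>2 * (real_of_int s1 - real_of_int s2)\<^sup>2"
    unfolding l' by (auto simp: min_def max_def)
  \<comment> \<open>In the difference of the squares of \<open>s1\<close> and \<open>s2\<close>
    everything cancels except the term with sin a sin b, whose square is (1 - k^2)(1 - h^2).\<close>
  also have "\<dots> = ((real_of_int s1)\<^sup>2 - (real_of_int s2)\<^sup>2)\<^sup>2" by algebra
  also have "\<dots> = (- 4 * c\<^sup>2 * q * (sin a * sin b))\<^sup>2"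
    unfolding s1 s2 by (simp add: algebra_simps)
  also have "\<dots> = 16 * ((c\<^sup>2)\<^sup>2 * (1 - k\<^sup>2) * (1 - h\<^sup>2))"
    unfolding power_mult_distrib ss qs by simp
  finally have prod: "(real_of_int l1)\<^sup>2 * (real_of_int l2)\<^sup>2 = (c\<^sup>2)\<^sup>2 * (1 - k\<^sup>2) * (1 - h\<^sup>2)"
    by (simp add: power_mult_distrib)
  \<comment> \<open>A common divisor \<open>d\<close> of the triple makes \<open>2 * d\<close> a
    divisor of the gcd of the \<open>s\<close>-combinations, which is normalized to 2.\<close>
  have d: "d dvd 1" if "d dvd l0" "d dvd l1" "d dvd l2" for d
  proof -
    have "2 * d dvd \<bar>s0\<bar>" "2 * d dvd min \<bar>s1 + s2\<bar> \<bar>s1 - s2\<bar>" "2 * d dvd max \<bar>s1 + s2\<bar> \<bar>s1 - s2\<bar>"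
      using that unfolding l[symmetric] by simp_all
    then have "2 * d dvd s0 \<and> 2 * d dvd s1 + s2 \<and> 2 * d dvd s1 - s2"
      by (auto simp: min_def max_def split: if_splits)
    then have "2 * d dvd gcd s0 (gcd (s1 + s2) (s1 - s2))" by simp
    then show ?thesis unfolding g by simp
  qed
  show thesis
  proof (rule that[of "c\<^sup>2"])
    have "0 \<le> 2 * l1" "0 \<le> 2 * l2" unfolding l by simp_all
    then show "0 \<le> l1" "0 \<le> l2" by simp_all
    show "(real_of_int l0)\<^sup>2 = c\<^sup>2 * (1 - h\<^sup>2)" using L0 s0 by simp
    show "(real_of_int l1)\<^sup>2 + (real_of_int l2)\<^sup>2 = 2 * c\<^sup>2 * (1 - q * k * h)"
      using L12 unfolding s1 s2 by (simp add: algebra_simps)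
  qed (use q k1 h1 prod d in auto)
qed

text \<open>If \<open>h = q * k\<close>, the quadratic polynomial with roots l1^2 and l2^2 has zero
  discriminant, forcing \<open>l1 = l2\<close>. The equivalence is the identity l1^2 + l2^2 - 2 l0^2
  = 2 C h (h - q k), where \<open>C\<close> is positive because \<open>l0\<close> is
  nonzero.\<close>

lemma flat_triple_condition:
  assumes "flat_triple (q, k, h) (l0, l1, l2)" "l0 \<noteq> 0" "l1 \<noteq> l2"
  shows "h \<noteq> q * k" "2 * (real_of_int l0)\<^sup>2 \<le> (real_of_int l1)\<^sup>2 + (real_of_int l2)\<^sup>2 \<longleftrightarrow> 0 \<le> h * (h - q * k)"
proof -
  from flat_tripleD[OF assms(1)] obtain C where C: "0 \<le> C" "\<bar>q\<bar> = 1" "0 \<le> l1" "0 \<le> l2"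
    and l: "(real_of_int l0)\<^sup>2 = C * (1 - h\<^sup>2)"
      "(real_of_int l1)\<^sup>2 + (real_of_int l2)\<^sup>2 = 2 * C * (1 - q * k * h)"
      "(real_of_int l1)\<^sup>2 * (real_of_int l2)\<^sup>2 = C\<^sup>2 * (1 - k\<^sup>2) * (1 - h\<^sup>2)"
    by metis
  have C0: "0 < C" using C(1) l(1) assms(2) by (cases "C = 0") auto
  have q2: "q * q = 1" using C(2) by (metis abs_mult_self_eq mult_1)
  show "h \<noteq> q * k"
  proof
    assume h: "h = q * k"
    have h2: "h\<^sup>2 = k\<^sup>2" "q * k * h = h\<^sup>2"
      unfolding h using q2 by (simp_all add: power2_eq_square algebra_simps)
    have "((real_of_int l1)\<^sup>2 - (real_of_int l2)\<^sup>2)\<^sup>2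
        = ((real_of_int l1)\<^sup>2 + (real_of_int l2)\<^sup>2)\<^sup>2 - 4 * ((real_of_int l1)\<^sup>2 * (real_of_int l2)\<^sup>2)"
      by algebra
    also have "\<dots> = 0" unfolding l h2(2) h2(1)[symmetric] by algebra
    finally have "real_of_int l1 = real_of_int l2"
      using C(3,4) by (simp add: power2_eq_iff_nonneg)
    then show False using assms(3) by simp
  qed
  have "(real_of_int l1)\<^sup>2 + (real_of_int l2)\<^sup>2 - 2 * (real_of_int l0)\<^sup>2 = 2 * C * (h * (h - q * k))"
    unfolding l by (simp add: power2_eq_square algebra_simps)
  then have "2 * (real_of_int l0)\<^sup>2 \<le> (real_of_int l1)\<^sup>2 + (real_of_int l2)\<^sup>2 \<longleftrightarrow> 0 \<le> 2 * C * (h * (h - q * k))"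
    by linarith
  also have "\<dots> \<longleftrightarrow> 0 \<le> h * (h - q * k)" using C0 by (simp add: zero_le_mult_iff)
  finally show "2 * (real_of_int l0)\<^sup>2 \<le> (real_of_int l1)\<^sup>2 + (real_of_int l2)\<^sup>2 \<longleftrightarrow> 0 \<le> h * (h - q * k)" .
qed

text \<open>Splits the hypothesis on the maximum into one inequality for each end, with
  \<open>m\<close> and \<open>n\<close> the first entries of the two triples.\<close>

lemma sqrt_condition:
  assumes "0 < m" "0 < n"
  shows "sqrt 2 * real_of_int (max m n) \<le> sqrt (real_of_int (l1\<^sup>2 + l2\<^sup>2)) \<longleftrightarrow>
    2 * (real_of_int m)\<^sup>2 \<le> (real_of_int l1)\<^sup>2 + (real_of_int l2)\<^sup>2 \<and>
    2 * (real_of_int n)\<^sup>2 \<le> (real_of_int l1)\<^sup>2 + (real_of_int l2)\<^sup>2"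
proof -
  have eq: "sqrt 2 * real_of_int x \<le> sqrt (real_of_int (l1\<^sup>2 + l2\<^sup>2)) \<longleftrightarrow>
      2 * (real_of_int x)\<^sup>2 \<le> (real_of_int l1)\<^sup>2 + (real_of_int l2)\<^sup>2" if "0 < x" for x
  proof -
    have "sqrt 2 * real_of_int x = sqrt (2 * (real_of_int x)\<^sup>2)"
      using that by (simp add: real_sqrt_mult)
    then show ?thesis by (simp only: real_sqrt_le_iff of_int_add of_int_power)
  qed
  have sq: "(real_of_int x)\<^sup>2 \<le> (real_of_int y)\<^sup>2" if "0 < x" "x \<le> y" for x y
    using that by (simp add: power_mono)
  show ?thesis
  proof (cases "m \<le> n")
    case True
    then show ?thesis using eq[OF assms(2)] sq[OF assms(1) True] by (simp add: max_def) linarith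
  next
    case False
    then show ?thesis using eq[OF assms(1)] sq[OF assms(2), of m] by (simp add: max_def) linarith
  qed
qed

text \<open>Since k^2 = 1, the product formula gives \<open>l1 = 0\<close>. Both ends have the same
  value of 1 - q k h, hence the same scaling constant, hence equal first entries; so
  \<open>l2 = 2 * l0\<close>, and coprimality leaves only \<open>l0 = 1\<close>.\<close>

lemma triple_of_symmetric_ends:
  assumes "flat_triple (q, k, h) (l0, l1, l2)" "flat_triple (- q, k, - h) (l1 + l2 - l0, l1, l2)"
    and "k\<^sup>2 = 1" "0 \<le> l1" "l1 < l0" "l0 < l2"
  shows "(l0, l1, l2) = (1, 0, 2)"
proof -
  from flat_tripleD[OF assms(1)] obtain C where
    l: "(real_of_int l0)\<^sup>2 = C * (1 - h\<^sup>2)"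
      "(real_of_int l1)\<^sup>2 + (real_of_int l2)\<^sup>2 = 2 * C * (1 - q * k * h)"
      "(real_of_int l1)\<^sup>2 * (real_of_int l2)\<^sup>2 = C\<^sup>2 * (1 - k\<^sup>2) * (1 - h\<^sup>2)"
    and dvd: "\<And>d. d dvd l0 \<Longrightarrow> d dvd l1 \<Longrightarrow> d dvd l2 \<Longrightarrow> d dvd 1"
    by metis
  from flat_tripleD[OF assms(2)] obtain C' where
    "(real_of_int (l1 + l2 - l0))\<^sup>2 = C' * (1 - (- h)\<^sup>2)"
    "(real_of_int l1)\<^sup>2 + (real_of_int l2)\<^sup>2 = 2 * C' * (1 - - q * k * - h)"
    by metis
  then have l': "(real_of_int (l1 + l2 - l0))\<^sup>2 = C' * (1 - h\<^sup>2)"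
      "(real_of_int l1)\<^sup>2 + (real_of_int l2)\<^sup>2 = 2 * C' * (1 - q * k * h)"
    by simp_all
  have l1: "l1 = 0" using l(3) assms(3-) by simp
  have "0 < (real_of_int l1)\<^sup>2 + (real_of_int l2)\<^sup>2" using assms by (simp add: sum_power2_gt_zero_iff)
  then have "1 - q * k * h \<noteq> 0" using l(2) by auto
  then have "C = C'" using l(2) l'(2) by simp
  then have "(real_of_int l0)\<^sup>2 = (real_of_int (l1 + l2 - l0))\<^sup>2" using l(1) l'(1) by simp
  then have "l0 = l1 + l2 - l0"
    using assms by (subst (asm) power2_eq_iff_nonneg) auto
  then have l2: "l2 = 2 * l0" using l1 by simp
  have "l0 dvd 1" by (rule dvd) (simp_all add: l1 l2)
  then show ?thesis using assms l1 l2 by simp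
qed


section \<open>Ends of intervals\<close>

text \<open>The ends may be infinite, so \<open>has_ends\<close> takes limits over the extended
  reals. Pushed forward to the reals, the filter is generated by initial segments of the
  interval.\<close>

lemma eventually_at_lower_end:
  assumes "a < b"
  shows "eventually P (filtermap real_of_ereal (at_right a)) \<longleftrightarrow>
    (\<exists>c\<in>einterval a b. \<forall>t\<in>einterval a b. t < c \<longrightarrow> P t)"
proof
  assume "eventually P (filtermap real_of_ereal (at_right a))"
  then obtain d where d: "a < d" "\<And>y. a < y \<Longrightarrow> y < d \<Longrightarrow> P (real_of_ereal y)"
    unfolding eventually_filtermap eventually_at_right[OF assms] by blast
  obtain c where "a < ereal c" "ereal c < min d b"
    using ereal_dense2[of a "min d b"] d(1) assms by auto
  moreover from this have "P t" if "t \<in> einterval a b" "t < c" for t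
    using d(2)[of "ereal t"] that less_trans[of "ereal t" "ereal c" d] by (simp add: einterval_iff)
  ultimately have "c \<in> einterval a b" "\<forall>t\<in>einterval a b. t < c \<longrightarrow> P t"
    by (simp_all add: einterval_iff)
  then show "\<exists>c\<in>einterval a b. \<forall>t\<in>einterval a b. t < c \<longrightarrow> P t" by blast
next
  assume "\<exists>c\<in>einterval a b. \<forall>t\<in>einterval a b. t < c \<longrightarrow> P t"
  then obtain c where c: "a < ereal c" "ereal c < b" "\<And>t. t \<in> einterval a b \<Longrightarrow> t < c \<Longrightarrow> P t"
    by (auto simp: einterval_iff)
  have "P (real_of_ereal y)" if "a < y" "y < ereal c" for y
  proof (cases y)
    case (real t)
    with that c(2) have "ereal t < b" by (meson less_trans)
    with real that show ?thesis by (intro c(3)) (auto simp: einterval_iff)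
  qed (use that in auto)
  then show "eventually P (filtermap real_of_ereal (at_right a))"
    unfolding eventually_filtermap eventually_at_right[OF assms] using c(1) by blast
qed

lemma eventually_at_upper_end:
  assumes "a < b"
  shows "eventually P (filtermap real_of_ereal (at_left b)) \<longleftrightarrow>
    (\<exists>c\<in>einterval a b. \<forall>t\<in>einterval a b. c < t \<longrightarrow> P t)"
proof
  assume "eventually P (filtermap real_of_ereal (at_left b))"
  then obtain d where d: "d < b" "\<And>y. d < y \<Longrightarrow> y < b \<Longrightarrow> P (real_of_ereal y)"
    unfolding eventually_filtermap eventually_at_left[OF assms] by blast
  obtain c where "max d a < ereal c" "ereal c < b"
    using ereal_dense2[of "max d a" b] d(1) assms by auto
  moreover from this have "P t" if "t \<in> einterval a b" "c < t" for t
    using d(2)[of "ereal t"] that less_trans[of d "ereal c" "ereal t"] by (simp add: einterval_iff)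
  ultimately have "c \<in> einterval a b" "\<forall>t\<in>einterval a b. c < t \<longrightarrow> P t"
    by (simp_all add: einterval_iff)
  then show "\<exists>c\<in>einterval a b. \<forall>t\<in>einterval a b. c < t \<longrightarrow> P t" by blast
next
  assume "\<exists>c\<in>einterval a b. \<forall>t\<in>einterval a b. c < t \<longrightarrow> P t"
  then obtain c where c: "a < ereal c" "ereal c < b" "\<And>t. t \<in> einterval a b \<Longrightarrow> c < t \<Longrightarrow> P t"
    by (auto simp: einterval_iff)
  have "P (real_of_ereal y)" if "ereal c < y" "y < b" for y
  proof (cases y)
    case (real t)
    with that c(1) have "a < ereal t" by (meson less_trans)
    with real that show ?thesis by (intro c(3)) (auto simp: einterval_iff)
  qed (use that in auto)
  then show "eventually P (filtermap real_of_ereal (at_left b))"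
    unfolding eventually_filtermap eventually_at_left[OF assms] using c(2) by blast
qed

text \<open>One notion for both settings in which ends occur: the possibly unbounded time interval
  of a curve, and the interval from 0 to 1 over which rotational curves become graphs.\<close>

definition lower_end :: "real filter \<Rightarrow> real set \<Rightarrow> bool" where
  "lower_end F T \<longleftrightarrow> T \<noteq> {} \<and> (\<forall>t\<in>T. \<exists>s\<in>T. s < t) \<and>
     (\<forall>P. eventually P F \<longleftrightarrow> (\<exists>c\<in>T. \<forall>t\<in>T. t < c \<longrightarrow> P t))"

definition upper_end :: "real filter \<Rightarrow> real set \<Rightarrow> bool" where
  "upper_end F T \<longleftrightarrow> T \<noteq> {} \<and> (\<forall>t\<in>T. \<exists>s\<in>T. t < s) \<and>
     (\<forall>P. eventually P F \<longleftrightarrow> (\<exists>c\<in>T. \<forall>t\<in>T. c < t \<longrightarrow> P t))"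

lemma lower_end_einterval:
  assumes "a < b" shows "lower_end (filtermap real_of_ereal (at_right a)) (einterval a b)"
proof -
  have "\<exists>s\<in>einterval a b. s < t" if "t \<in> einterval a b" for t
  proof -
    obtain s where "a < ereal s" "ereal s < ereal t"
      using ereal_dense2[of a "ereal t"] \<open>t \<in> einterval a b\<close> by (auto simp: einterval_iff)
    then show ?thesis
      using that less_trans[of "ereal s" "ereal t" b] by (intro bexI[of _ s]) (auto simp: einterval_iff)
  qed
  moreover have "einterval a b \<noteq> {}"
    using ereal_dense2[OF assms] by (auto simp: einterval_iff)
  ultimately show ?thesis unfolding lower_end_def eventually_at_lower_end[OF assms] by blast
qed

lemma upper_end_einterval:
  assumes "a < b" shows "upper_end (filtermap real_of_ereal (at_left b)) (einterval a b)"
proof -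
  have "\<exists>s\<in>einterval a b. t < s" if "t \<in> einterval a b" for t
  proof -
    obtain s where "ereal t < ereal s" "ereal s < b"
      using ereal_dense2[of "ereal t" b] \<open>t \<in> einterval a b\<close> by (auto simp: einterval_iff)
    then show ?thesis
      using that less_trans[of a "ereal t" "ereal s"] by (intro bexI[of _ s]) (auto simp: einterval_iff)
  qed
  moreover have "einterval a b \<noteq> {}"
    using ereal_dense2[OF assms] by (auto simp: einterval_iff)
  ultimately show ?thesis unfolding upper_end_def eventually_at_upper_end[OF assms] by blast
qed

lemma lower_end_Ioo: "lower_end (at_right (0::real)) {0<..<1}"
proof -
  have "\<exists>s\<in>{0<..<1}. s < t" if "t \<in> {0<..<1}" for t :: real
    using that by (intro bexI[of _ "t/2"]) auto
  moreover have "eventually P (at_right (0::real)) \<longleftrightarrow> (\<exists>c\<in>{0<..<1}. \<forall>t\<in>{0<..<1}. t < c \<longrightarrow> P t)" for P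
  proof
    assume "eventually P (at_right (0::real))"
    then obtain d where "0 < d" "\<And>y. 0 < y \<Longrightarrow> y < d \<Longrightarrow> P y"
      unfolding eventually_at_right[OF zero_less_one] by blast
    then show "\<exists>c\<in>{0<..<1}. \<forall>t\<in>{0<..<1}. t < c \<longrightarrow> P t"
      by (intro bexI[of _ "min d (1/2)"]) auto
  next
    assume "\<exists>c\<in>{0<..<1}. \<forall>t\<in>{0<..<1}. t < c \<longrightarrow> P t"
    then obtain c where "c \<in> {0<..<1}" "\<forall>t\<in>{0<..<1}. t < c \<longrightarrow> P t" by blast
    then show "eventually P (at_right (0::real))"
      unfolding eventually_at_right[OF zero_less_one] by (intro exI[of _ c]) auto
  qed
  moreover have "{0<..<1::real} \<noteq> {}" by simp
  ultimately show ?thesis unfolding lower_end_def by blast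
qed

lemma upper_end_Ioo: "upper_end (at_left (1::real)) {0<..<1}"
proof -
  have "\<exists>s\<in>{0<..<1}. t < s" if "t \<in> {0<..<1}" for t :: real
    using that by (intro bexI[of _ "(1 + t)/2"]) auto
  moreover have "eventually P (at_left (1::real)) \<longleftrightarrow> (\<exists>c\<in>{0<..<1}. \<forall>t\<in>{0<..<1}. c < t \<longrightarrow> P t)" for P
  proof
    assume "eventually P (at_left (1::real))"
    then obtain d where "d < 1" "\<And>y. d < y \<Longrightarrow> y < 1 \<Longrightarrow> P y"
      unfolding eventually_at_left[OF zero_less_one] by blast
    then show "\<exists>c\<in>{0<..<1}. \<forall>t\<in>{0<..<1}. c < t \<longrightarrow> P t"
      by (intro bexI[of _ "max d (1/2)"]) auto
  next
    assume "\<exists>c\<in>{0<..<1}. \<forall>t\<in>{0<..<1}. c < t \<longrightarrow> P t"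
    then obtain c where "c \<in> {0<..<1}" "\<forall>t\<in>{0<..<1}. c < t \<longrightarrow> P t" by blast
    then show "eventually P (at_left (1::real))"
      unfolding eventually_at_left[OF zero_less_one] by (intro exI[of _ c]) auto
  qed
  moreover have "{0<..<1::real} \<noteq> {}" by simp
  ultimately show ?thesis unfolding upper_end_def by blast
qed

lemma lower_endD:
  assumes "lower_end F T"
  shows "F \<noteq> bot" "eventually (\<lambda>t. t \<in> T) F" "c \<in> T \<Longrightarrow> eventually (\<lambda>t. t \<in> T \<and> t < c) F"
    "eventually P F \<Longrightarrow> \<exists>c\<in>T. \<forall>t\<in>T. t < c \<longrightarrow> P t"
proof -
  have ne: "T \<noteq> {}" and ex: "\<forall>t\<in>T. \<exists>s\<in>T. s < t"
    and ev: "eventually R F \<longleftrightarrow> (\<exists>c\<in>T. \<forall>t\<in>T. t < c \<longrightarrow> R t)" for R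
    using assms unfolding lower_end_def by blast+
  show "F \<noteq> bot"
    unfolding eventually_False[symmetric] ev using ex by blast
  show "eventually (\<lambda>t. t \<in> T) F" unfolding ev using ne by blast
  show "eventually (\<lambda>t. t \<in> T \<and> t < c) F" if "c \<in> T" unfolding ev using that by blast
  show "\<exists>c\<in>T. \<forall>t\<in>T. t < c \<longrightarrow> P t" if "eventually P F" using that unfolding ev .
qed

lemma upper_endD:
  assumes "upper_end F T"
  shows "F \<noteq> bot" "eventually (\<lambda>t. t \<in> T) F" "c \<in> T \<Longrightarrow> eventually (\<lambda>t. t \<in> T \<and> c < t) F"
    "eventually P F \<Longrightarrow> \<exists>c\<in>T. \<forall>t\<in>T. c < t \<longrightarrow> P t"
proof -
  have ne: "T \<noteq> {}" and ex: "\<forall>t\<in>T. \<exists>s\<in>T. t < s"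
    and ev: "eventually R F \<longleftrightarrow> (\<exists>c\<in>T. \<forall>t\<in>T. c < t \<longrightarrow> R t)" for R
    using assms unfolding upper_end_def by blast+
  show "F \<noteq> bot"
    unfolding eventually_False[symmetric] ev using ex by blast
  show "eventually (\<lambda>t. t \<in> T) F" unfolding ev using ne by blast
  show "eventually (\<lambda>t. t \<in> T \<and> c < t) F" if "c \<in> T" unfolding ev using that by blast
  show "\<exists>c\<in>T. \<forall>t\<in>T. c < t \<longrightarrow> P t" if "eventually P F" using that unfolding ev .
qed

section \<open>Limits of monotone functions and intermediate values\<close>

text \<open>An intermediate point \<open>t\<close> before \<open>c\<close> makes the bound strict:
  the limit is at least \<open>f t\<close>, which exceeds \<open>f c\<close>.\<close>

lemma less_lower_limit:
  fixes f :: "real \<Rightarrow> real"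
  assumes F: "lower_end F T" and f: "strict_antimono_on T f" and L: "(f \<longlongrightarrow> L) F" and c: "c \<in> T"
  shows "f c < L"
proof -
  obtain t where t: "t \<in> T" "t < c"
    using F c unfolding lower_end_def by blast
  then have "f c < f t" using f c by (auto simp: monotone_on_def)
  moreover have "eventually (\<lambda>s. f t \<le> f s) F"
    using lower_endD(3)[OF F t(1)] by eventually_elim (use f t in \<open>auto simp: monotone_on_def intro: less_imp_le\<close>)
  then have "f t \<le> L" by (rule tendsto_lowerbound[OF L _ lower_endD(1)[OF F]])
  ultimately show ?thesis by linarith
qed

lemma upper_limit_less:
  fixes f :: "real \<Rightarrow> real"
  assumes F: "upper_end F T" and f: "strict_antimono_on T f" and L: "(f \<longlongrightarrow> L) F" and c: "c \<in> T"
  shows "L < f c"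
proof -
  obtain t where t: "t \<in> T" "c < t"
    using F c unfolding upper_end_def by blast
  then have "f t < f c" using f c by (auto simp: monotone_on_def)
  moreover have "eventually (\<lambda>s. f s \<le> f t) F"
    using upper_endD(3)[OF F t(1)] by eventually_elim (use f t in \<open>auto simp: monotone_on_def intro: less_imp_le\<close>)
  then have "L \<le> f t" by (rule tendsto_upperbound[OF L _ upper_endD(1)[OF F]])
  ultimately show ?thesis by linarith
qed

lemma strict_antimono_onI_deriv:
  fixes f :: "real \<Rightarrow> real"
  assumes T: "is_interval T"
    and f: "\<And>t. t \<in> T \<Longrightarrow> (f has_real_derivative f' t) (at t)" "\<And>t. t \<in> T \<Longrightarrow> f' t < 0"
  shows "strict_antimono_on T f"
proof (rule monotone_onI)
  fix s t assume st: "s \<in> T" "t \<in> T" "s < t"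
  then have "x \<in> T" if "s \<le> x" "x \<le> t" for x
    using T that unfolding is_interval_1 by blast
  with f show "f t < f s"
    by (intro DERIV_neg_imp_decreasing[OF st(3)]) blast
qed

text \<open>Points of \<open>T\<close> with values on either side of \<open>y\<close> exist near the
  two limits. Neither filter is tied to a particular end of \<open>T\<close>, so increasing and
  decreasing functions are covered alike.\<close>

lemma IVT_limits:
  fixes f :: "real \<Rightarrow> real"
  assumes T: "connected T" "continuous_on T f"
    and F: "F \<noteq> bot" "eventually (\<lambda>t. t \<in> T) F" "(f \<longlongrightarrow> L) F" "L < y"
    and F': "F' \<noteq> bot" "eventually (\<lambda>t. t \<in> T) F'" "(f \<longlongrightarrow> L') F'" "y < L'"
  obtains t where "t \<in> T" "f t = y"
proof -
  obtain s where s: "s \<in> T" "f s < y"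
    using eventually_happens'[OF F(1) eventually_conj[OF F(2) order_tendstoD(2)[OF F(3,4)]]] by blast
  obtain t where t: "t \<in> T" "y < f t"
    using eventually_happens'[OF F'(1) eventually_conj[OF F'(2) order_tendstoD(1)[OF F'(3,4)]]] by blast
  have "connected (f ` T)" using T by (intro connected_continuous_image)
  then have "y \<in> f ` T"
    by (rule connectedD_interval[OF _ imageI[OF s(1)] imageI[OF t(1)] less_imp_le[OF s(2)] less_imp_le[OF t(2)]])
  then show thesis using that by blast
qed


section \<open>Monotonicity along the flow\<close>

lemma E'_K'_mult_sign:
  assumes "\<bar>\<sigma>\<bar> = 1" shows "E' (\<sigma> * q) = E' q" "K' (\<sigma> * q) = K' q"
proof -
  have "\<sigma> = 1 \<or> \<sigma> = - 1" using assms by linarith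
  then have "(\<sigma> * q)\<^sup>2 = q\<^sup>2" by auto
  then show "E' (\<sigma> * q) = E' q" "K' (\<sigma> * q) = K' q" by (simp_all add: E'_def K'_def)
qed

text \<open>The flow is invariant under \<open>(q, k, h) \<mapsto> (-q, k, -h)\<close>, so one may pass to
  \<open>Q = \<bar>q\<bar>\<close> and \<open>w = sgn q * h\<close>.\<close>

locale positive_flow =
  fixes T :: "real set" and Q k w :: "real \<Rightarrow> real"
  assumes T: "open T" "is_interval T"
    and Q: "\<And>t. t \<in> T \<Longrightarrow> 0 < Q t" "\<And>t. t \<in> T \<Longrightarrow> Q t < 1"
    and w: "\<And>t. t \<in> T \<Longrightarrow> (w t)\<^sup>2 < 1"
    and dQ: "\<And>t. t \<in> T \<Longrightarrow>
      (Q has_real_derivative Q t * (E' (Q t) * k t - Q t * K' (Q t) * w t)) (at t)"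
    and dk: "\<And>t. t \<in> T \<Longrightarrow> (k has_real_derivative
      (1 - (k t)\<^sup>2) / (1 - (Q t)\<^sup>2) * ((1 + (Q t)\<^sup>2) * E' (Q t) - 2 * (Q t)\<^sup>2 * K' (Q t))) (at t)"
    and dw: "\<And>t. t \<in> T \<Longrightarrow> (w has_real_derivative
      Q t * (1 - (w t)\<^sup>2) / (1 - (Q t)\<^sup>2) * (2 * E' (Q t) - (1 + (Q t)\<^sup>2) * K' (Q t))) (at t)"

text \<open>The coordinate q never vanishes on the connected time interval, so its limit
  \<open>\<sigma>\<close> along \<open>F\<close> fixes its sign throughout. In the applications
  \<open>F\<close> is the filter of a flat end.\<close>

lemma positive_flow_of_integral_curve:
  assumes \<gamma>: "integral_curve a b \<gamma>"
    and F: "F \<noteq> bot" "eventually (\<lambda>t. t \<in> einterval a b) F" "(\<gamma> \<longlongrightarrow> (\<sigma>, k0, h0)) F"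
    and \<sigma>: "\<bar>\<sigma>\<bar> = 1"
  shows "positive_flow (einterval a b) (\<lambda>t. \<sigma> * fst (\<gamma> t)) (\<lambda>t. fst (snd (\<gamma> t)))
    (\<lambda>t. \<sigma> * snd (snd (\<gamma> t)))"
proof -
  let ?T = "einterval a b"
  define q k h where "q t = fst (\<gamma> t)" and "k t = fst (snd (\<gamma> t))" and "h t = snd (snd (\<gamma> t))" for t
  note defs = q_def k_def h_def
  have \<gamma>_eq: "\<gamma> t = (q t, k t, h t)" for t by (simp add: defs)
  have \<sigma>': "\<sigma> = 1 \<or> \<sigma> = - 1" using \<sigma> by linarith
  then have \<sigma>2: "\<sigma> * \<sigma> = 1" "\<sigma>\<^sup>2 = 1" by auto
  have gen: "0 < \<bar>q t\<bar>" "\<bar>q t\<bar> < 1" "(k t)\<^sup>2 \<le> 1" "(h t)\<^sup>2 < 1"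
    and d: "(\<gamma> has_vector_derivative flow_field (\<gamma> t)) (at t)" if "t \<in> ?T" for t
    using \<gamma> that \<gamma>_eq unfolding integral_curve_def genus_one_data_def by force+
  have dq: "(q has_real_derivative fst (flow_field (\<gamma> t))) (at t)"
    and dk: "(k has_real_derivative fst (snd (flow_field (\<gamma> t)))) (at t)"
    and dh: "(h has_real_derivative snd (snd (flow_field (\<gamma> t)))) (at t)" if "t \<in> ?T" for t
    unfolding defs has_real_derivative_iff_has_vector_derivative
    by (intro bounded_linear.has_vector_derivative[OF bounded_linear_fst]
        bounded_linear.has_vector_derivative[OF bounded_linear_snd] d that)+
  have iv: "is_interval ?T"
    unfolding is_interval_1
  proof (intro ballI allI impI)
    fix s t x assume "s \<in> ?T" "t \<in> ?T" "s \<le> x \<and> x \<le> t"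
    then have "a < ereal s" "ereal s \<le> ereal x" "ereal x \<le> ereal t" "ereal t < b"
      by (auto simp: einterval_iff)
    then show "x \<in> ?T" unfolding einterval_iff by (blast intro: less_le_trans le_less_trans)
  qed
  have cont: "continuous_on ?T (\<lambda>t. \<sigma> * q t)"
    by (intro continuous_intros DERIV_continuous_on[OF has_field_derivative_at_within[OF dq]])
  have lim: "((\<lambda>t. \<sigma> * q t) \<longlongrightarrow> 1) F"
    using tendsto_mult_left[OF tendsto_fst[OF F(3)], of \<sigma>] by (simp add: defs \<sigma>2)
  have pos: "0 < \<sigma> * q t" if "t \<in> ?T" for t
  proof (rule ccontr)
    assume np: "\<not> 0 < \<sigma> * q t"
    have nz: "\<sigma> * q s \<noteq> 0" if "s \<in> ?T" for s using gen(1)[OF that] \<sigma>' by auto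
    have neg: "\<sigma> * q t < 0" using np nz[OF that] by linarith
    obtain s where s: "s \<in> ?T" "0 < \<sigma> * q s"
      using eventually_happens'[OF F(1) eventually_conj[OF F(2) order_tendstoD(1)[OF lim zero_less_one]]]
      by blast
    have "connected ((\<lambda>t. \<sigma> * q t) ` ?T)"
      using cont iv by (intro connected_continuous_image is_interval_connected)
    then have "0 \<in> (\<lambda>t. \<sigma> * q t) ` ?T"
      by (rule connectedD_interval[OF _ imageI[OF that] imageI[OF s(1)] less_imp_le[OF neg] less_imp_le[OF s(2)]])
    then show False using nz by force
  qed
  have sq: "(\<sigma> * x)\<^sup>2 = x\<^sup>2" for x by (simp add: power_mult_distrib \<sigma>2)
  note EK = E'_K'_mult_sign[OF \<sigma>]
  show ?thesis
  proof (fold defs, unfold_locales)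
    fix t assume t: "t \<in> ?T"
    show "\<sigma> * q t < 1" using gen(2)[OF t] \<sigma>' by auto
    have "((\<lambda>t. \<sigma> * q t) has_real_derivative \<sigma> * (q t * (E' (q t) * k t - q t * K' (q t) * h t))) (at t)"
      using DERIV_cmult[OF dq[OF t], of \<sigma>] unfolding \<gamma>_eq flow_field_def Let_def E'_def K'_def by simp
    moreover have eq: "\<sigma> * q t * K' (q t) * (\<sigma> * h t) = q t * K' (q t) * h t"
      using \<sigma>' by auto
    ultimately show "((\<lambda>t. \<sigma> * q t) has_real_derivative
        \<sigma> * q t * (E' (\<sigma> * q t) * k t - \<sigma> * q t * K' (\<sigma> * q t) * (\<sigma> * h t))) (at t)"
      unfolding EK eq by (simp only: mult.assoc)
    show "(k has_real_derivative (1 - (k t)\<^sup>2) / (1 - (\<sigma> * q t)\<^sup>2) *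
        ((1 + (\<sigma> * q t)\<^sup>2) * E' (\<sigma> * q t) - 2 * (\<sigma> * q t)\<^sup>2 * K' (\<sigma> * q t))) (at t)"
      using dk[OF t] unfolding EK sq \<gamma>_eq flow_field_def Let_def E'_def K'_def by simp
    show "((\<lambda>t. \<sigma> * h t) has_real_derivative \<sigma> * q t * (1 - (\<sigma> * h t)\<^sup>2) / (1 - (\<sigma> * q t)\<^sup>2) *
        (2 * E' (\<sigma> * q t) - (1 + (\<sigma> * q t)\<^sup>2) * K' (\<sigma> * q t))) (at t)"
      using DERIV_cmult[OF dh[OF t], of \<sigma>]
      unfolding EK sq \<gamma>_eq flow_field_def Let_def E'_def K'_def by (simp add: mult.assoc)
    show "0 < \<sigma> * q t" using t by (rule pos)
    show "(\<sigma> * h t)\<^sup>2 < 1" unfolding sq using t by (rule gen)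
  next
    show "open ?T" by (rule open_einterval)
    show "is_interval ?T" by (rule iv)
  qed
qed

context positive_flow
begin

lemma Q': "t \<in> T \<Longrightarrow> 0 < \<bar>Q t\<bar> \<and> \<bar>Q t\<bar> \<le> 1" "t \<in> T \<Longrightarrow> \<bar>Q t\<bar> < 1" "t \<in> T \<Longrightarrow> (Q t)\<^sup>2 < 1"
  using Q[of t] by (auto simp: abs_square_less_1)

lemma connected_T: "connected T"
  using T(2) by (rule is_interval_connected)

lemma continuous_on_w: "continuous_on T w"
  by (rule DERIV_continuous_on[OF has_field_derivative_at_within[OF dw]])

lemma continuous_on_Q: "continuous_on T Q"
  by (rule DERIV_continuous_on[OF has_field_derivative_at_within[OF dQ]])

text \<open>The sign of the derivative comes from \<open>two_E'_less\<close>; the other factor is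
  positive since Q and the square of w stay below 1.\<close>

lemma strict_antimono_w: "strict_antimono_on T w"
proof (rule strict_antimono_onI_deriv[OF T(2) dw])
  fix t assume t: "t \<in> T"
  have "0 < Q t * (1 - (w t)\<^sup>2) / (1 - (Q t)\<^sup>2)"
    using t Q(1)[OF t] w[OF t] Q'(3)[OF t] by simp
  moreover have "2 * E' (Q t) - (1 + (Q t)\<^sup>2) * K' (Q t) < 0"
    using two_E'_less[of "Q t"] Q'[OF t] by simp
  ultimately show "Q t * (1 - (w t)\<^sup>2) / (1 - (Q t)\<^sup>2) * (2 * E' (Q t) - (1 + (Q t)\<^sup>2) * K' (Q t)) < 0"
    by (rule mult_pos_neg)
qed

text \<open>The field component for \<open>Q\<close> is the only one without the factor 1/(1 - Q^2),
  so it has a limit at a flat end, obtained by inserting pi/2 for both integrals.\<close>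

lemma tendsto_dQ:
  assumes F: "eventually (\<lambda>t. t \<in> T) F"
    and l: "(Q \<longlongrightarrow> 1) F" "(k \<longlongrightarrow> k0) F" "(w \<longlongrightarrow> w0) F"
  shows "((\<lambda>t. Q t * (E' (Q t) * k t - Q t * K' (Q t) * w t)) \<longlongrightarrow> pi / 2 * (k0 - w0)) F"
proof -
  have "((\<lambda>t. \<bar>Q t\<bar>) \<longlongrightarrow> 1) F" using tendsto_rabs[OF l(1)] by simp
  note EK = tendsto_E'_K'[OF this eventually_mono[OF F Q'(1)]]
  have lim: "((\<lambda>t. Q t * (E' (Q t) * k t - Q t * K' (Q t) * w t)) \<longlongrightarrow>
      1 * (pi / 2 * k0 - 1 * (pi / 2) * w0)) F"
    by (intro tendsto_intros EK l)
  have "1 * (pi / 2 * k0 - 1 * (pi / 2) * w0) = pi / 2 * (k0 - w0)"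
    by (simp add: right_diff_distrib diff_divide_distrib)
  with lim show ?thesis by (simp only:)
qed

text \<open>Near an end with \<open>Q \<rightarrow> 1\<close> the sign of \<open>k - w\<close> is that of the derivative of \<open>Q\<close>, which is
  prescribed by \<open>Q < 1\<close>.\<close>

lemma lower_end_le:
  assumes F: "lower_end F T" and l: "(Q \<longlongrightarrow> 1) F" "(k \<longlongrightarrow> k0) F" "(w \<longlongrightarrow> w0) F"
  shows "k0 \<le> w0"
proof (rule ccontr)
  note F' = lower_endD[OF F]
  assume "\<not> k0 \<le> w0"
  then have "0 < pi / 2 * (k0 - w0)" by simp
  from order_tendstoD(1)[OF tendsto_dQ[OF F'(2) l] this]
  obtain c where c: "c \<in> T"
    "\<And>t. t \<in> T \<Longrightarrow> t < c \<Longrightarrow> 0 < Q t * (E' (Q t) * k t - Q t * K' (Q t) * w t)"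
    using F'(4) by blast
  obtain u where u: "u \<in> T" "u < c" using F c(1) unfolding lower_end_def by blast
  \<comment> \<open>With positive slope near the lower end, \<open>Q\<close> would stay below
    \<open>Q u\<close> all the way down, and its limit 1 would be at most \<open>Q u\<close>, which
    is less than 1.\<close>
  have "Q t \<le> Q u" if "t \<in> T" "t < u" for t
  proof -
    have *: "x \<in> T \<and> x < c" if "t \<le> x" "x \<le> u" for x
    proof
      show "x \<in> T" using T(2) u(1) \<open>t \<in> T\<close> that unfolding is_interval_1 by blast
      show "x < c" using that u(2) by simp
    qed
    show ?thesis
      by (rule less_imp_le, rule DERIV_pos_imp_increasing[OF that(2)]) (use * dQ c(2) in blast)
  qed
  then have "eventually (\<lambda>t. Q t \<le> Q u) F" using F'(3)[OF u(1)] by (auto elim: eventually_mono)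
  then have "1 \<le> Q u" by (rule tendsto_upperbound[OF l(1) _ F'(1)])
  with Q(2)[OF u(1)] show False by simp
qed

lemma upper_end_le:
  assumes F: "upper_end F T" and l: "(Q \<longlongrightarrow> 1) F" "(k \<longlongrightarrow> k0) F" "(w \<longlongrightarrow> w0) F"
  shows "w0 \<le> k0"
proof (rule ccontr)
  note F' = upper_endD[OF F]
  assume "\<not> w0 \<le> k0"
  then have "pi / 2 * (k0 - w0) < 0" by (simp add: mult_pos_neg)
  from order_tendstoD(2)[OF tendsto_dQ[OF F'(2) l] this]
  obtain c where c: "c \<in> T"
    "\<And>t. t \<in> T \<Longrightarrow> c < t \<Longrightarrow> Q t * (E' (Q t) * k t - Q t * K' (Q t) * w t) < 0"
    using F'(4) by blast
  obtain u where u: "u \<in> T" "c < u" using F c(1) unfolding upper_end_def by blast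
  have "Q t \<le> Q u" if "t \<in> T" "u < t" for t
  proof -
    have *: "x \<in> T \<and> c < x" if "u \<le> x" "x \<le> t" for x
    proof
      show "x \<in> T" using T(2) u(1) \<open>t \<in> T\<close> that unfolding is_interval_1 by blast
      show "c < x" using that u(2) by simp
    qed
    show ?thesis
      by (rule less_imp_le, rule DERIV_neg_imp_decreasing[OF that(2)]) (use * dQ c(2) in blast)
  qed
  then have "eventually (\<lambda>t. Q t \<le> Q u) F" using F'(3)[OF u(1)] by (auto elim: eventually_mono)
  then have "1 \<le> Q u" by (rule tendsto_upperbound[OF l(1) _ F'(1)])
  with Q(2)[OF u(1)] show False by simp
qed

end


section \<open>Rotational curves as graphs\<close>

text \<open>The quotient dy/dx of the flow for x = Q and y = k w on the invariant set k^2 = 1. The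
  factor k enters the derivatives of both x and y and cancels, so the equation is the same for k = 1
  and k = -1.\<close>

definition graph_slope :: "real \<Rightarrow> real \<Rightarrow> real" where
  "graph_slope x y = (1 - y\<^sup>2) * (2 * E' x - (1 + x\<^sup>2) * K' x) /
     ((1 - x\<^sup>2) * (E' x - x * K' x * y))"

text \<open>The values at 0 (bouquet) and 1 (flat torus) are one-sided limits, because the
  differential equation is imposed only strictly between them.\<close>

definition graph_solution :: "(real \<Rightarrow> real) \<Rightarrow> real \<Rightarrow> real \<Rightarrow> bool" where
  "graph_solution g L0 L1 \<longleftrightarrow>
     (\<forall>x\<in>{0<..<1}. (g x)\<^sup>2 < 1 \<and> (g has_real_derivative graph_slope x (g x)) (at x)) \<and>
     (g \<longlongrightarrow> L0) (at_right 0) \<and> (g \<longlongrightarrow> L1) (at_left 1)"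

text \<open>As \<open>y\<close> < 1, the subtracted term is less than \<open>x * K' x\<close>, which
  is at most \<open>E' x\<close> by \<open>q_K'_le_E'\<close>. This positivity makes Q monotone
  along rotational curves.\<close>

lemma graph_denominator_pos:
  assumes "0 < x" "x < 1" "y\<^sup>2 < 1"
  shows "0 < E' x - x * K' x * y"
proof -
  have y: "y < 1" using assms(3) by (simp add: abs_square_less_1)
  have "0 < x * K' x" using assms K'_pos[of x] by simp
  then have "x * K' x * y < x * K' x * 1" using y by (rule mult_strict_left_mono[rotated])
  also have "\<dots> \<le> E' x" using q_K'_le_E'[of x] assms by simp
  finally show ?thesis by simp
qed

lemma graph_slope_neg:
  assumes "0 < x" "x < 1" "y\<^sup>2 < 1"
  shows "graph_slope x y < 0"
proof -
  have "2 * E' x - (1 + x\<^sup>2) * K' x < 0" using two_E'_less[of x] assms by simp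
  moreover have "x\<^sup>2 < 1" using assms by (simp add: abs_square_less_1)
  ultimately show ?thesis
    unfolding graph_slope_def using graph_denominator_pos[OF assms] assms(3)
    by (intro divide_neg_pos mult_pos_neg mult_pos_pos) simp_all
qed

text \<open>The dependence on the unknown sits in (1 - y^2)/(e - a y), which increases for y at most
  0; the factor depending on \<open>x\<close> alone is nonpositive and reverses the order.\<close>

lemma graph_slope_antimono:
  assumes x: "0 < x" "x < 1" and y: "y\<^sup>2 < 1" "z\<^sup>2 < 1" and yz: "y \<le> z" "z \<le> 0"
  shows "graph_slope x z \<le> graph_slope x y"
proof -
  define a e where "a = x * K' x" and "e = E' x"
  have a: "0 < a" unfolding a_def using x K'_pos[of x] by simp
  have e: "0 < e" unfolding e_def using x E'_pos[of x] by simp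
  have d: "0 < e - a * y" "0 < e - a * z"
    using graph_denominator_pos[OF x] y unfolding a_def e_def by blast+
  \<comment> \<open>Cross multiplication exposes the factor \<open>z - y\<close>; the cofactor is
    nonnegative because \<open>y\<close> and \<open>z\<close> are both at most 0.\<close>
  have "(1 - z\<^sup>2) * (e - a * y) - (1 - y\<^sup>2) * (e - a * z) = (z - y) * (a * (1 + y * z) - e * (y + z))"
    by algebra
  moreover have "0 \<le> y * z" using yz by (simp add: mult_nonpos_nonpos)
  then have "0 \<le> a * (1 + y * z)" using a by simp
  moreover have "e * (y + z) \<le> 0" using e yz by (simp add: mult_nonneg_nonpos)
  ultimately have "(1 - y\<^sup>2) * (e - a * z) \<le> (1 - z\<^sup>2) * (e - a * y)"
    using yz(1) by (smt (verit) mult_nonneg_nonneg)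
  then have le: "(1 - y\<^sup>2) / (e - a * y) \<le> (1 - z\<^sup>2) / (e - a * z)"
    using d by (simp add: divide_le_eq pos_le_divide_eq)
  have "2 * E' x - (1 + x\<^sup>2) * K' x < 0" using two_E'_less[of x] x by simp
  moreover have "x\<^sup>2 < 1" using x by (simp add: abs_square_less_1)
  ultimately have neg: "(2 * E' x - (1 + x\<^sup>2) * K' x) / (1 - x\<^sup>2) \<le> 0"
    by (intro divide_nonpos_nonneg) simp_all
  have eq: "graph_slope x v = (2 * E' x - (1 + x\<^sup>2) * K' x) / (1 - x\<^sup>2) * ((1 - v\<^sup>2) / (e - a * v))" for v
    unfolding graph_slope_def a_def e_def by simp
  show ?thesis unfolding eq by (rule mult_left_mono_neg[OF le neg])
qed

lemma graph_solution_antimono: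
  assumes "graph_solution g L0 L1" shows "strict_antimono_on {0<..<1} g"
proof (rule strict_antimono_onI_deriv)
  show "(g has_real_derivative graph_slope x (g x)) (at x)" if "x \<in> {0<..<1}" for x
    using assms that unfolding graph_solution_def by blast
  show "graph_slope x (g x) < 0" if "x \<in> {0<..<1}" for x
    using assms that graph_slope_neg[of x "g x"] unfolding graph_solution_def by simp
qed (simp add: is_interval_1)

lemma graph_solution_continuous:
  assumes "graph_solution g L0 L1" shows "continuous_on {0<..<1} g"
proof (rule DERIV_continuous_on[OF has_field_derivative_at_within])
  show "(g has_real_derivative graph_slope x (g x)) (at x)" if "x \<in> {0<..<1}" for x
    using assms that unfolding graph_solution_def by blast
qed

lemma graph_solution_bounds:
  assumes "graph_solution g L0 L1" "x \<in> {0<..<1}"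
  shows "g x < L0" "L1 < g x"
  using less_lower_limit[OF lower_end_Ioo graph_solution_antimono[OF assms(1)] _ assms(2)]
    upper_limit_less[OF upper_end_Ioo graph_solution_antimono[OF assms(1)] _ assms(2)]
    assms(1) unfolding graph_solution_def by blast+

text \<open>The equation is singular at \<open>x = 0\<close>, but its right hand side is antimonotone in the
  unknown on \<open>y \<le> 0\<close>, so the square of the difference of two solutions cannot increase.\<close>

lemma graph_solution_unique:
  assumes g: "graph_solution g 0 L" and f: "graph_solution f 0 M"
  shows "L = M"
proof -
  let ?d = "\<lambda>x. (g x - f x)\<^sup>2"
  have zero: "g x = f x" if x: "x \<in> {0<..<1}" for x
  proof -
    have "?d x \<le> ?d y" if y: "0 < y" "y \<le> x" for y
    proof (rule DERIV_nonpos_imp_nonincreasing[OF y(2)])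
      fix u assume u: "y \<le> u" "u \<le> x"
      then have u01: "u \<in> {0<..<1}" using x y by auto
      have gu: "(g u)\<^sup>2 < 1" "(g has_real_derivative graph_slope u (g u)) (at u)" "g u \<le> 0"
        using g u01 graph_solution_bounds(1)[OF g u01] unfolding graph_solution_def by auto
      have fu: "(f u)\<^sup>2 < 1" "(f has_real_derivative graph_slope u (f u)) (at u)" "f u \<le> 0"
        using f u01 graph_solution_bounds(1)[OF f u01] unfolding graph_solution_def by auto
      have "(?d has_real_derivative 2 * (g u - f u) * (graph_slope u (g u) - graph_slope u (f u))) (at u)"
        by (auto intro!: derivative_eq_intros gu(2) fu(2))
      moreover have "(g u - f u) * (graph_slope u (g u) - graph_slope u (f u)) \<le> 0"
        using graph_slope_antimono[of u "f u" "g u"] graph_slope_antimono[of u "g u" "f u"] gu fu u01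
        by (cases "f u \<le> g u") (simp_all add: mult_nonneg_nonpos mult_nonpos_nonneg)
      then have "2 * (g u - f u) * (graph_slope u (g u) - graph_slope u (f u)) \<le> 0"
        by (simp only: mult.assoc)
      ultimately show "\<exists>D. (?d has_real_derivative D) (at u) \<and> D \<le> 0" by blast
    qed
    \<comment> \<open>Letting \<open>y\<close> tend to 0, where both solutions tend to 0, bounds the
      squared difference at \<open>x\<close> by 0.\<close>
    then have "eventually (\<lambda>y. ?d x \<le> ?d y) (at_right 0)"
      using eventually_at_right_less[of 0] lower_endD(3)[OF lower_end_Ioo x]
      by (auto elim: eventually_mono)
    moreover have "(?d \<longlongrightarrow> (0 - 0)\<^sup>2) (at_right 0)"
      using g f unfolding graph_solution_def by (intro tendsto_intros) blast+
    ultimately have "?d x \<le> 0"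
      using tendsto_lowerbound[of ?d "(0 - 0)\<^sup>2" "at_right 0" "?d x"] by simp
    then show ?thesis by simp
  qed
  have "eventually (\<lambda>x. g x = f x) (at_left 1)"
    using upper_endD(2)[OF upper_end_Ioo] by eventually_elim (rule zero)
  then have "(f \<longlongrightarrow> L) (at_left 1)"
    using g unfolding graph_solution_def by (blast intro: Lim_transform_eventually)
  then show ?thesis
    using f tendsto_unique[OF trivial_limit_at_left_real] unfolding graph_solution_def by blast
qed

section \<open>Reparametrization of a rotational curve by \<open>Q\<close>\<close>

context positive_flow
begin

text \<open>Along a rotational curve \<open>Q\<close> is strictly monotone, so it can replace time
  as the coordinate. \<open>F0\<close> and \<open>F1\<close> may be either end, because the sign of
  \<open>\<kappa>\<close> decides whether the flow leaves or approaches the bouquet.\<close>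

lemma graph_exists:
  assumes k: "\<And>t. t \<in> T \<Longrightarrow> k t = \<kappa>" "\<kappa>\<^sup>2 = 1"
    and F0: "F0 \<noteq> bot" "eventually (\<lambda>t. t \<in> T) F0" "(Q \<longlongrightarrow> 0) F0" "(w \<longlongrightarrow> w0) F0"
    and F1: "F1 \<noteq> bot" "eventually (\<lambda>t. t \<in> T) F1" "(Q \<longlongrightarrow> 1) F1" "(w \<longlongrightarrow> w1) F1"
  obtains g where "graph_solution g (\<kappa> * w0) (\<kappa> * w1)" "\<And>t. t \<in> T \<Longrightarrow> g (Q t) = \<kappa> * w t"
    "Q ` T = {0<..<1}"
proof -
  have \<kappa>: "\<kappa> * \<kappa> = 1" using k(2) by (simp add: power2_eq_square)
  have sq: "(\<kappa> * x)\<^sup>2 = x\<^sup>2" for x by (simp add: power_mult_distrib k(2))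
  have den: "0 < E' (Q t) - Q t * K' (Q t) * (\<kappa> * w t)" if "t \<in> T" for t
    using Q[OF that] w[OF that] by (intro graph_denominator_pos) (simp_all add: sq)
  have dQ_eq: "Q t * (E' (Q t) * k t - Q t * K' (Q t) * w t)
      = \<kappa> * (Q t * (E' (Q t) - Q t * K' (Q t) * (\<kappa> * w t)))" if "t \<in> T" for t
  proof -
    have "\<kappa> * (Q t * K' (Q t) * (\<kappa> * w t)) = \<kappa> * \<kappa> * (Q t * K' (Q t) * w t)" by simp
    then show ?thesis unfolding k(1)[OF that] \<kappa> by (simp add: algebra_simps)
  qed
  \<comment> \<open>\<open>Q\<close> increases for \<open>\<kappa>\<close> = 1 and decreases for
    \<open>\<kappa>\<close> = -1; the factor \<open>- \<kappa>\<close> merges the two cases.\<close>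
  have mono: "strict_antimono_on T (\<lambda>t. - \<kappa> * Q t)"
  proof (rule strict_antimono_onI_deriv[OF T(2) DERIV_cmult[OF dQ]])
    fix t assume t: "t \<in> T"
    have "- \<kappa> * (Q t * (E' (Q t) * k t - Q t * K' (Q t) * w t))
        = - (\<kappa> * \<kappa> * (Q t * (E' (Q t) - Q t * K' (Q t) * (\<kappa> * w t))))"
      unfolding dQ_eq[OF t] by (simp only: mult_minus_left mult.assoc)
    moreover have "0 < Q t * (E' (Q t) - Q t * K' (Q t) * (\<kappa> * w t))"
      by (rule mult_pos_pos[OF Q(1)[OF t] den[OF t]])
    ultimately show "- \<kappa> * (Q t * (E' (Q t) * k t - Q t * K' (Q t) * w t)) < 0"
      unfolding \<kappa> by linarith
  qed
  have inj: "inj_on Q T"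
  proof (rule inj_onI)
    fix s t assume st: "s \<in> T" "t \<in> T" "Q s = Q t"
    with mono have "\<not> s < t" "\<not> t < s" unfolding monotone_on_def by fastforce+
    then show "s = t" by simp
  qed
  define r where "r = inv_into T Q"
  have r: "r (Q t) = t" if "t \<in> T" for t unfolding r_def using inj that by (rule inv_into_f_f)
  define g where "g x = \<kappa> * w (r x)" for x
  have g: "g (Q t) = \<kappa> * w t" if "t \<in> T" for t by (simp add: g_def r that)
  have img: "Q ` T = {0<..<1}"
  proof
    show "Q ` T \<subseteq> {0<..<1}" using Q by auto
    show "{0<..<1} \<subseteq> Q ` T"
      using IVT_limits[OF connected_T continuous_on_Q F0(1-3) _ F1(1-3)] by force
  qed
  have dg: "(g has_real_derivative graph_slope x (g x)) (at x)" and g1: "(g x)\<^sup>2 < 1"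
    if x: "x \<in> {0<..<1}" for x
  proof -
    obtain t where t: "t \<in> T" "x = Q t" using x img by blast
    show "(g x)\<^sup>2 < 1" unfolding t(2) g[OF t(1)] sq using t(1) by (rule w)
    let ?D = "\<kappa> * (Q t * (E' (Q t) - Q t * K' (Q t) * (\<kappa> * w t)))"
    have \<kappa>0: "\<kappa> \<noteq> 0" using \<kappa> by auto
    have D0: "?D \<noteq> 0" using \<kappa>0 den[OF t(1)] Q(1)[OF t(1)] by simp
    have inv: "(*) D \<circ> (*) (inverse D) = id" if "D \<noteq> 0" for D :: real
      using that by (auto simp: fun_eq_iff)
    have "(r has_derivative (*) (inverse ?D)) (at (Q t))"
    proof (rule has_derivative_inverse_strong[OF T(1) t(1) continuous_on_Q r])
      show "(Q has_derivative (*) ?D) (at t)"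
        using dQ[OF t(1)] unfolding dQ_eq[OF t(1)] has_field_derivative_def .
      show "(*) ?D \<circ> (*) (inverse ?D) = id"
        using D0 by (rule inv)
    qed
    then have dr: "(r has_real_derivative inverse ?D) (at (Q t))" unfolding has_field_derivative_def .
    let ?W = "Q t * (1 - (w t)\<^sup>2) / (1 - (Q t)\<^sup>2) * (2 * E' (Q t) - (1 + (Q t)\<^sup>2) * K' (Q t))"
    have "(w has_real_derivative ?W) (at (r (Q t)))" unfolding r[OF t(1)] by (rule dw[OF t(1)])
    from DERIV_cmult[OF DERIV_chain2[OF this dr], of \<kappa>]
    have "(g has_real_derivative \<kappa> * (?W * inverse ?D)) (at (Q t))" unfolding g_def .
    \<comment> \<open>The factors \<open>\<kappa>\<close> and \<open>Q t\<close> in the derivative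
      of \<open>\<kappa> * w\<close> cancel against those in \<open>?D\<close>.\<close>
    moreover have "\<kappa> * (Q t * (inverse \<kappa> * inverse (Q t))) = 1"
      using \<kappa>0 Q(1)[OF t(1)] by (simp add: field_simps)
    then have "\<kappa> * (?W * inverse ?D) = graph_slope (Q t) (g (Q t))"
      unfolding g[OF t(1)] graph_slope_def sq
      by (simp add: divide_inverse inverse_mult_distrib)
    ultimately show "(g has_real_derivative graph_slope x (g x)) (at x)" unfolding t(2) by simp
  qed
  have anti: "strict_antimono_on {0<..<1} g"
    using dg graph_slope_neg g1
    by (intro strict_antimono_onI_deriv[of _ g "\<lambda>x. graph_slope x (g x)"]) (auto simp: is_interval_1)
  \<comment> \<open>Limits are transferred from time to \<open>Q\<close> by monotonicity:
    \<open>\<kappa> * w0\<close> bounds all values of \<open>g\<close>, and a single value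
    \<open>\<kappa> * w t\<close> close to it bounds \<open>g\<close> from below to the left of
    \<open>Q t\<close>.\<close>
  have "(g \<longlongrightarrow> \<kappa> * w0) (at_right 0)"
  proof (rule order_tendstoI)
    note kw = tendsto_mult_left[OF F0(4), of \<kappa>]
    fix y
    have "g x \<le> \<kappa> * w0" if x: "x \<in> {0<..<1}" for x
    proof (rule tendsto_lowerbound[OF kw _ F0(1)])
      have "eventually (\<lambda>t. Q t < x) F0" using F0(3) x by (intro order_tendstoD) auto
      then show "eventually (\<lambda>t. g x \<le> \<kappa> * w t) F0" using F0(2)
      proof eventually_elim
        case (elim t)
        then have "g x < g (Q t)" using anti x Q(1)[of t] Q(2)[of t] by (auto simp: monotone_on_def)
        with elim show ?case by (simp add: g)
      qed
    qed
    then show "eventually (\<lambda>x. g x < y) (at_right 0)" if "\<kappa> * w0 < y"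
      using lower_endD(2)[OF lower_end_Ioo] that by (auto elim!: eventually_mono intro: le_less_trans)
    show "eventually (\<lambda>x. y < g x) (at_right 0)" if y: "y < \<kappa> * w0"
    proof -
      obtain t where t: "t \<in> T" "y < \<kappa> * w t"
        using eventually_happens'[OF F0(1) eventually_conj[OF F0(2) order_tendstoD(1)[OF kw y]]] by blast
      have Qt: "Q t \<in> {0<..<1}" using t img by blast
      from lower_endD(3)[OF lower_end_Ioo this] show ?thesis
      proof eventually_elim
        case (elim x)
        then have "g (Q t) < g x" using anti Qt by (auto simp: monotone_on_def)
        with t g show ?case by auto
      qed
    qed
  qed
  moreover have "(g \<longlongrightarrow> \<kappa> * w1) (at_left 1)"
  proof (rule order_tendstoI)
    note kw = tendsto_mult_left[OF F1(4), of \<kappa>]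
    fix y
    have "\<kappa> * w1 \<le> g x" if x: "x \<in> {0<..<1}" for x
    proof (rule tendsto_upperbound[OF kw _ F1(1)])
      have "eventually (\<lambda>t. x < Q t) F1" using F1(3) x by (intro order_tendstoD) auto
      then show "eventually (\<lambda>t. \<kappa> * w t \<le> g x) F1" using F1(2)
      proof eventually_elim
        case (elim t)
        then have "g (Q t) < g x" using anti x Q(1)[of t] Q(2)[of t] by (auto simp: monotone_on_def)
        with elim show ?case by (simp add: g)
      qed
    qed
    then show "eventually (\<lambda>x. y < g x) (at_left 1)" if "y < \<kappa> * w1"
      using upper_endD(2)[OF upper_end_Ioo] that by (auto elim!: eventually_mono intro: less_le_trans)
    show "eventually (\<lambda>x. g x < y) (at_left 1)" if y: "\<kappa> * w1 < y"
    proof -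
      obtain t where t: "t \<in> T" "\<kappa> * w t < y"
        using eventually_happens'[OF F1(1) eventually_conj[OF F1(2) order_tendstoD(2)[OF kw y]]] by blast
      have Qt: "Q t \<in> {0<..<1}" using t img by blast
      from upper_endD(3)[OF upper_end_Ioo this] show ?thesis
      proof eventually_elim
        case (elim x)
        then have "g x < g (Q t)" using anti Qt by (auto simp: monotone_on_def)
        with t g show ?case by auto
      qed
    qed
  qed
  ultimately have "graph_solution g (\<kappa> * w0) (\<kappa> * w1)"
    unfolding graph_solution_def using dg g1 by blast
  then show thesis using g img by (rule that)
qed

end


section \<open>Minimal tori in flow families\<close>

lemma flat_torusD:
  assumes "flat_torus (q, k, h)"
  shows "\<bar>q\<bar> = 1" "h\<^sup>2 < 1" "cmc_torus (q, k, h)"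
proof -
  show "\<bar>q\<bar> = 1" and c: "cmc_torus (q, k, h)" using assms unfolding flat_torus_def by simp_all
  from c obtain \<theta>1 \<theta>2 where "sym_angles k h \<theta>1 \<theta>2" unfolding cmc_torus_def by fast
  then have "0 < sin (\<theta>1 - \<theta>2)" "h = cos (\<theta>1 - \<theta>2)"
    unfolding sym_angles_def by (auto intro: sin_gt_zero)
  then show "h\<^sup>2 < 1" by (simp add: cos_squared_eq)
qed

lemma minimal_iff: "h\<^sup>2 < 1 \<Longrightarrow> minimal (q, k, h) \<longleftrightarrow> h = 0"
  by (auto simp: minimal_def mean_curvature_def)

text \<open>Minimality means h = 0, so uniqueness reduces to h being an injective coordinate on the
  family.\<close>

lemma ex1_minimal:
  assumes "inj_on (\<lambda>p. snd (snd p)) F" and "\<And>q k h. (q, k, h) \<in> F \<Longrightarrow> h\<^sup>2 < 1"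
    and "\<exists>q k. (q, k, 0) \<in> F"
  shows "\<exists>!p. p \<in> F \<and> minimal p"
proof -
  obtain q k where 0: "(q, k, 0) \<in> F" using assms(3) by blast
  show ?thesis
  proof (rule ex1I)
    show "(q, k, 0) \<in> F \<and> minimal (q, k, 0)" using 0 by (simp add: minimal_iff)
    fix p assume p: "p \<in> F \<and> minimal p"
    obtain q' k' h' where p_eq: "p = (q', k', h')" by (cases p)
    with p assms(2) have "h' = 0" by (metis minimal_iff)
    then show "p = (q, k, 0)" using inj_onD[OF assms(1), of p "(q, k, 0)"] p 0 p_eq by simp
  qed
qed

lemma zero_le_mult_sign:
  fixes x y :: real
  shows "0 < y \<Longrightarrow> 0 \<le> x * y \<longleftrightarrow> 0 \<le> x" "y < 0 \<Longrightarrow> 0 \<le> x * y \<longleftrightarrow> x \<le> 0"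
  by (auto simp: zero_le_mult_iff)

text \<open>The function \<open>w = q * h\<close> falls strictly from its value at the first end to
  that at the second. By \<open>ne\<close> the weak end inequalities for k - w become strict, so
  each sign condition fixes the sign of one end value.\<close>

lemma nonrotational_family_minimal:
  assumes fam: "nonrotational_flow_family F (q, k, h) (q', k', h')"
    and ne: "h \<noteq> q * k" "h' \<noteq> q' * k'"
  shows "p \<in> F \<Longrightarrow> cmc_torus p"
    and "0 \<le> h * (h - q * k) \<Longrightarrow> 0 \<le> h' * (h' - q' * k') \<Longrightarrow> \<exists>!p. p \<in> F \<and> minimal p"
    and "p \<in> F \<Longrightarrow> minimal p \<Longrightarrow> 0 \<le> h * (h - q * k) \<and> 0 \<le> h' * (h' - q' * k')"
proof -
  from fam obtain a b \<gamma> where c: "curve_of_tori a b \<gamma>" and e: "has_ends a b \<gamma> (q, k, h) (q', k', h')"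
    and P: "flat_torus (q, k, h)" and P': "flat_torus (q', k', h')"
    and F: "F = \<gamma> ` einterval a b \<union> {(q, k, h), (q', k', h')}"
    unfolding nonrotational_flow_family_def by blast
  have ic: "integral_curve a b \<gamma>" and tori: "\<And>t. t \<in> einterval a b \<Longrightarrow> cmc_torus (\<gamma> t)"
    using c unfolding curve_of_tori_def maximal_integral_curve_def by blast+
  show "p \<in> F \<Longrightarrow> cmc_torus p"
    using tori flat_torusD(3)[OF P] flat_torusD(3)[OF P'] unfolding F by blast
  have ab: "a < b" using ic unfolding integral_curve_def by blast
  let ?T = "einterval a b"
  let ?A = "filtermap real_of_ereal (at_right a)" and ?B = "filtermap real_of_ereal (at_left b)"
  note A = lower_end_einterval[OF ab] and B = upper_end_einterval[OF ab]
  have limA: "(\<gamma> \<longlongrightarrow> (q, k, h)) ?A" and limB: "(\<gamma> \<longlongrightarrow> (q', k', h')) ?B"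
    using e unfolding has_ends_def tendsto_compose_filtermap by blast+
  note q = flat_torusD(1)[OF P]
  define Q K w where "Q t = q * fst (\<gamma> t)" and "K t = fst (snd (\<gamma> t))" and "w t = q * snd (snd (\<gamma> t))" for t
  interpret positive_flow ?T Q K w
    using positive_flow_of_integral_curve[OF ic lower_endD(1,2)[OF A] limA q] unfolding Q_def K_def w_def .
  have q': "q = 1 \<or> q = - 1" using q by linarith
  then have qq: "q * q = 1" by auto
  have \<gamma>: "\<gamma> t = (q * Q t, K t, q * w t)" for t
    unfolding Q_def K_def w_def mult.assoc[symmetric] qq by simp
  have A': "(Q \<longlongrightarrow> 1) ?A" "(K \<longlongrightarrow> k) ?A" "(w \<longlongrightarrow> q * h) ?A"
    using tendsto_mult_left[OF tendsto_fst[OF limA], of q] tendsto_fst[OF tendsto_snd[OF limA]]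
      tendsto_mult_left[OF tendsto_snd[OF tendsto_snd[OF limA]], of q]
    unfolding Q_def K_def w_def by (simp_all add: qq)
  have B': "(Q \<longlongrightarrow> q * q') ?B" "(K \<longlongrightarrow> k') ?B" "(w \<longlongrightarrow> q * h') ?B"
    using tendsto_mult_left[OF tendsto_fst[OF limB], of q] tendsto_fst[OF tendsto_snd[OF limB]]
      tendsto_mult_left[OF tendsto_snd[OF tendsto_snd[OF limB]], of q]
    unfolding Q_def K_def w_def by simp_all
  \<comment> \<open>The limit of the positive function \<open>Q\<close> at the upper end is
    \<open>q * q'\<close>, so both flat ends have the same sign of q.\<close>
  have "0 \<le> q * q'"
    by (rule tendsto_lowerbound[OF B'(1) _ upper_endD(1)[OF B]])
      (use upper_endD(2)[OF B] Q(1) in \<open>auto elim!: eventually_mono intro: less_imp_le\<close>)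
  then have qq': "q' = q" using q flat_torusD(1)[OF P'] q' by auto
  have ends: "k \<le> q * h" "q * h' \<le> k'"
    using lower_end_le[OF A A'] upper_end_le[OF B _ B'(2,3)] B'(1) unfolding qq' qq by blast+
  moreover have "k \<noteq> q * h" "q * h' \<noteq> k'"
    using ne unfolding qq' using q' by auto
  ultimately have lt: "k < q * h" "q * h' < k'" by auto
  \<comment> \<open>By \<open>lt\<close> the second factor is positive here and, in the analogous
    identity at the other end, negative.\<close>
  have "h * (h - q * k) = q * h * (q * h - k)" using q' by auto
  then have cond: "0 \<le> h * (h - q * k) \<longleftrightarrow> 0 \<le> q * h"
    using zero_le_mult_sign(1)[of "q * h - k" "q * h"] lt(1) by linarith
  have "h' * (h' - q' * k') = q * h' * (q * h' - k')" using q' unfolding qq' by auto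
  then have cond': "0 \<le> h' * (h' - q' * k') \<longleftrightarrow> q * h' \<le> 0"
    using zero_le_mult_sign(2)[of "q * h' - k'" "q * h'"] lt(2) by linarith
  have wb: "q * h' < w t" "w t < q * h" if "t \<in> ?T" for t
    using upper_limit_less[OF B strict_antimono_w B'(3) that]
      less_lower_limit[OF A strict_antimono_w A'(3) that] by blast+
  obtain t0 where "t0 \<in> ?T" using A unfolding lower_end_def by blast
  from wb[OF this] have hh: "q * h' < q * h" by linarith
  have Fcases: "(\<exists>t\<in>?T. p = \<gamma> t \<and> q * snd (snd p) = w t) \<or> p = (q, k, h) \<or> p = (q', k', h')"
    if "p \<in> F" for p
    using that unfolding F w_def by blast
  have "w s \<noteq> w t" if "s \<in> ?T" "t \<in> ?T" "s \<noteq> t" for s t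
    using strict_antimono_w that unfolding monotone_on_def by (metis less_irrefl linorder_neqE)
  then have inj: "inj_on (\<lambda>p. snd (snd p)) F"
    using Fcases wb hh by (intro inj_onI) (smt (verit, best) fst_conv snd_conv)
  have h1: "z\<^sup>2 < 1" if "(x, y, z) \<in> F" for x y z
  proof -
    have "(q * w t)\<^sup>2 < 1" if "t \<in> ?T" for t using w[OF that] q' by auto
    then show ?thesis
      using that flat_torusD(2)[OF P] flat_torusD(2)[OF P'] unfolding F \<gamma> by auto
  qed
  show "\<exists>!p. p \<in> F \<and> minimal p" if "0 \<le> h * (h - q * k)" "0 \<le> h' * (h' - q' * k')"
  proof -
    have "0 \<le> q * h" "q * h' \<le> 0" using that cond cond' by blast+
    \<comment> \<open>Either an end is itself minimal, or \<open>w\<close> changes sign and vanishes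
      in between.\<close>
    then consider "h = 0" | "h' = 0" | "0 < q * h" "q * h' < 0" using q' by force
    then have "\<exists>x y. (x, y, 0) \<in> F"
    proof cases
      case 3
      obtain t where "t \<in> ?T" "w t = 0"
        by (rule IVT_limits[OF connected_T continuous_on_w upper_endD(1,2)[OF B] B'(3) 3(2)
              lower_endD(1,2)[OF A] A'(3) 3(1)])
      then have "(q * Q t, K t, 0) \<in> F" using \<gamma>[of t] unfolding F by force
      then show ?thesis by blast
    qed (auto simp: F)
    from ex1_minimal[OF inj _ this] show ?thesis using h1 by blast
  qed
  show "0 \<le> h * (h - q * k) \<and> 0 \<le> h' * (h' - q' * k')" if "p \<in> F" "minimal p"
  proof -
    have "snd (snd p) = 0" using that h1 minimal_iff by (metis prod.collapse)
    with Fcases[OF that(1)] show ?thesis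
      unfolding cond cond' using wb hh by force
  qed
qed

section \<open>Rotational arcs and their gluing at the bouquet\<close>

text \<open>Parametrizing by \<open>Q\<close> forgets the direction of the flow and describes the
  arc as a graph from the bouquet (x = 0) to the flat torus (x = 1). The sign \<open>q * k\<close>
  recovers h from the normalized unknown.\<close>

lemma rotational_arcE:
  assumes "rotational_arc C S (q, k, h)"
  obtains s g where "S = (0, k, s)" "s\<^sup>2 < 1" "k\<^sup>2 = 1" "flat_torus (q, k, h)"
    "\<forall>p\<in>C. cmc_torus p"
    "C = (\<lambda>x. (q * x, k, q * k * g x)) ` {0<..<1}" "graph_solution g (q * k * s) (q * k * h)"
proof -
  from assms obtain a b \<gamma> where c: "curve_of_tori a b \<gamma>"
    and rot: "\<And>t. t \<in> einterval a b \<Longrightarrow> rotational (\<gamma> t)"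
    and e: "has_ends a b \<gamma> S (q, k, h) \<or> has_ends a b \<gamma> (q, k, h) S"
    and S: "sphere_bouquet S" and P: "flat_torus (q, k, h)" and C: "C = \<gamma> ` einterval a b"
    unfolding rotational_arc_def by blast
  have ic: "integral_curve a b \<gamma>" and tori: "\<And>t. t \<in> einterval a b \<Longrightarrow> cmc_torus (\<gamma> t)"
    using c unfolding curve_of_tori_def maximal_integral_curve_def by blast+
  have ab: "a < b" using ic unfolding integral_curve_def by blast
  let ?T = "einterval a b"
  note A = lower_end_einterval[OF ab] and B = upper_end_einterval[OF ab]
  \<comment> \<open>\<open>A0\<close> is the end at the bouquet and \<open>A1\<close> the end at the
    flat torus, in whichever order time runs through them.\<close>
  obtain A0 A1 where A0: "A0 \<noteq> bot" "eventually (\<lambda>t. t \<in> ?T) A0" "(\<gamma> \<longlongrightarrow> S) A0"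
    and A1: "A1 \<noteq> bot" "eventually (\<lambda>t. t \<in> ?T) A1" "(\<gamma> \<longlongrightarrow> (q, k, h)) A1"
    using e lower_endD(1,2)[OF A] upper_endD(1,2)[OF B]
    unfolding has_ends_def tendsto_compose_filtermap by blast
  obtain k0 s where S_eq: "S = (0, k0, s)" and s: "s\<^sup>2 < 1"
    using S unfolding sphere_bouquet_def by (cases S) auto
  note q = flat_torusD(1)[OF P]
  define Q K w where "Q t = q * fst (\<gamma> t)" and "K t = fst (snd (\<gamma> t))" and "w t = q * snd (snd (\<gamma> t))" for t
  interpret positive_flow ?T Q K w
    using positive_flow_of_integral_curve[OF ic A1 q] unfolding Q_def K_def w_def .
  have q': "q = 1 \<or> q = - 1" using q by linarith
  then have qq: "q * q = 1" by auto
  have \<gamma>: "\<gamma> t = (q * Q t, K t, q * w t)" for t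
    unfolding Q_def K_def w_def mult.assoc[symmetric] qq by simp
  have K2: "(K t)\<^sup>2 = 1" if "t \<in> ?T" for t
    using rot[OF that] unfolding \<gamma> rotational_def by simp
  \<comment> \<open>The k-component of the field has the factor 1 - k^2, which vanishes on
    rotational data.\<close>
  have "(K has_real_derivative 0) (at t within ?T)" if "t \<in> ?T" for t
    using has_field_derivative_at_within[OF dk[OF that]] K2[OF that] by simp
  then obtain \<kappa> where \<kappa>: "\<And>t. t \<in> ?T \<Longrightarrow> K t = \<kappa>"
    using has_field_derivative_zero_constant[OF is_interval_convex[OF T(2)]] by blast
  have lims: "(Q \<longlongrightarrow> 0) A0" "(K \<longlongrightarrow> k0) A0" "(w \<longlongrightarrow> q * s) A0"
    using tendsto_mult_left[OF tendsto_fst[OF A0(3)], of q] tendsto_fst[OF tendsto_snd[OF A0(3)]]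
      tendsto_mult_left[OF tendsto_snd[OF tendsto_snd[OF A0(3)]], of q]
    unfolding Q_def K_def w_def S_eq by simp_all
  have lims': "(Q \<longlongrightarrow> 1) A1" "(K \<longlongrightarrow> k) A1" "(w \<longlongrightarrow> q * h) A1"
    using tendsto_mult_left[OF tendsto_fst[OF A1(3)], of q] tendsto_fst[OF tendsto_snd[OF A1(3)]]
      tendsto_mult_left[OF tendsto_snd[OF tendsto_snd[OF A1(3)]], of q]
    unfolding Q_def K_def w_def by (simp_all add: qq)
  have "(K \<longlongrightarrow> \<kappa>) A0" "(K \<longlongrightarrow> \<kappa>) A1"
    by (intro tendsto_eventually eventually_mono[OF A0(2)] eventually_mono[OF A1(2)] \<kappa>; assumption)+
  then have k: "k0 = \<kappa>" "k = \<kappa>"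
    using tendsto_unique[OF A0(1) lims(2)] tendsto_unique[OF A1(1) lims'(2)] by blast+
  obtain t0 where t0: "t0 \<in> ?T" using A unfolding lower_end_def by blast
  have k2: "k\<^sup>2 = 1" using K2[OF t0] unfolding \<kappa>[OF t0] k(2) .
  from graph_exists[OF \<kappa>[folded k(2)] k2 A0(1,2) lims(1,3) A1(1,2) lims'(1,3)]
  obtain g where g: "graph_solution g (k * (q * s)) (k * (q * h))" "\<And>t. t \<in> ?T \<Longrightarrow> g (Q t) = k * w t"
    "Q ` ?T = {0<..<1}" by blast
  have "\<gamma> t = (q * Q t, k, q * k * g (Q t))" if "t \<in> ?T" for t
  proof -
    have "q * k * g (Q t) = q * (k\<^sup>2 * w t)" unfolding g(2)[OF that] by (simp add: power2_eq_square)
    then have "q * w t = q * k * g (Q t)" unfolding k2 by (simp only: mult_1_left)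
    then show ?thesis using \<gamma>[of t] \<kappa>[OF that] k(2) by simp
  qed
  then have "C = (\<lambda>x. (q * x, k, q * k * g x)) ` (Q ` ?T)"
    unfolding C image_image by (intro image_cong) simp_all
  then have C': "C = (\<lambda>x. (q * x, k, q * k * g x)) ` {0<..<1}" unfolding g(3) .
  show thesis
    by (rule that[of s g]) (use S_eq k s k2 P tori C C' g(1) in \<open>auto simp: mult_ac\<close>)
qed

text \<open>The values of \<open>v\<close> separate the five pieces: \<open>h\<close>, then the
  first arc, then \<open>s\<close>, then the second arc, then \<open>h'\<close>; within an arc
  injectivity is inherited from \<open>f\<close> or \<open>f'\<close>.\<close>

lemma inj_on_glued_arcs:
  fixes v :: "'a \<Rightarrow> real"
  assumes F: "\<And>p. p \<in> F \<Longrightarrow> (\<exists>x\<in>I. p = u x \<and> v p = f x \<and> v p < s \<and> h < v p) \<or>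
      (\<exists>x\<in>I. p = u' x \<and> v p = f' x \<and> s < v p \<and> v p < h') \<or>
      p = S \<and> v p = s \<or> p = P \<and> v p = h \<or> p = P' \<and> v p = h'"
    and "h < s" "s < h'" "inj_on f I" "inj_on f' I"
  shows "inj_on v F"
proof (rule inj_onI)
  fix p p' assume "p \<in> F" "p' \<in> F" "v p = v p'"
  with F[OF this(1)] F[OF this(2)] assms(2-) show "p = p'"
    by (elim disjE bexE conjE) (auto dest: inj_onD)
qed

text \<open>With \<open>\<epsilon> = q * k\<close>, the quantity \<open>\<epsilon>\<close> times h
  increases from the first flat torus through the bouquet to the second, since q changes sign at the
  bouquet and turns the decreasing graph of the second arc around. The last conclusion treats the
  bouquet as the minimal member.\<close>

lemma rotational_family_minimal:
  assumes fam: "rotational_flow_family F (q, k, h) (q', k', h')"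
  shows "0 \<le> h * (h - q * k) \<Longrightarrow> 0 \<le> h' * (h' - q' * k') \<Longrightarrow> \<exists>!p. p \<in> F \<and> minimal p"
    and "p \<in> F \<Longrightarrow> minimal p \<Longrightarrow> 0 \<le> h * (h - q * k) \<and> 0 \<le> h' * (h' - q' * k')"
    and "p \<in> F \<Longrightarrow> minimal p \<Longrightarrow> \<not> cmc_torus p \<Longrightarrow> q' = - q \<and> k' = k \<and> h' = - h \<and> k\<^sup>2 = 1"
proof -
  from fam obtain S C C' where arc: "rotational_arc C S (q, k, h)" and arc': "rotational_arc C' S (q', k', h')"
    and opp: "q * q' < 0" and F: "F = C \<union> C' \<union> {S, (q, k, h), (q', k', h')}"
    unfolding rotational_flow_family_def by auto
  obtain s g where S: "S = (0, k, s)" "s\<^sup>2 < 1" and k2: "k\<^sup>2 = 1" and P: "flat_torus (q, k, h)"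
    and tori: "\<forall>p\<in>C. cmc_torus p"
    and C: "C = (\<lambda>x. (q * x, k, q * k * g x)) ` {0<..<1}" and g: "graph_solution g (q * k * s) (q * k * h)"
    by (rule rotational_arcE[OF arc])
  obtain s' g' where S': "S = (0, k', s')" "s'\<^sup>2 < 1" and k2': "k'\<^sup>2 = 1" and P': "flat_torus (q', k', h')"
    and tori': "\<forall>p\<in>C'. cmc_torus p"
    and C': "C' = (\<lambda>x. (q' * x, k', q' * k' * g' x)) ` {0<..<1}"
    and g': "graph_solution g' (q' * k' * s') (q' * k' * h')"
    by (rule rotational_arcE[OF arc'])
  have q: "\<bar>q\<bar> = 1" "\<bar>q'\<bar> = 1" using flat_torusD(1)[OF P] flat_torusD(1)[OF P'] .
  have eqs: "k' = k" "s' = s" using S(1) S'(1) by simp_all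
  have q': "q' = - q" using q opp by (auto simp: abs_if mult_less_0_iff split: if_splits)
  define \<epsilon> where "\<epsilon> = q * k"
  have \<epsilon>: "\<epsilon> = 1 \<or> \<epsilon> = - 1" using q(1) k2 unfolding \<epsilon>_def power2_eq_1_iff by (auto simp: abs_if split: if_splits)
  have C: "C = (\<lambda>x. (q * x, k, \<epsilon> * g x)) ` {0<..<1}" and g: "graph_solution g (\<epsilon> * s) (\<epsilon> * h)"
    using C g unfolding \<epsilon>_def .
  have C': "C' = (\<lambda>x. (- q * x, k, - (\<epsilon> * g' x))) ` {0<..<1}"
    and g': "graph_solution g' (- (\<epsilon> * s)) (- (\<epsilon> * h'))"
    using C' g' unfolding \<epsilon>_def eqs q' by simp_all
  have gb: "\<epsilon> * h < g x" "g x < \<epsilon> * s" "\<epsilon> * s < - g' x" "- g' x < \<epsilon> * h'" if "x \<in> {0<..<1}" for x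
    using graph_solution_bounds[OF g that] graph_solution_bounds[OF g' that] by simp_all
  have "(1/2::real) \<in> {0<..<1}" by simp
  from gb[OF this] have hs: "\<epsilon> * h < \<epsilon> * s" "\<epsilon> * s < \<epsilon> * h'" by simp_all
  have Fcases: "(\<exists>x\<in>{0<..<1}. p = (q * x, k, \<epsilon> * g x) \<and> \<epsilon> * snd (snd p) = g x) \<or>
      (\<exists>x\<in>{0<..<1}. p = (- q * x, k, - (\<epsilon> * g' x)) \<and> \<epsilon> * snd (snd p) = - g' x) \<or>
      p = S \<or> p = (q, k, h) \<or> p = (q', k', h')" if "p \<in> F" for p
    using that \<epsilon> unfolding F C C' by auto
  have gi: "inj_on g {0<..<1}" "inj_on (\<lambda>x. - g' x) {0<..<1}"
    using graph_solution_antimono[OF g] graph_solution_antimono[OF g']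
    unfolding monotone_on_def inj_on_def by (metis less_irrefl linorder_neqE neg_equal_iff_equal)+
  have inj: "inj_on (\<lambda>p. \<epsilon> * snd (snd p)) F"
  proof (rule inj_on_glued_arcs[OF _ hs gi])
    let ?v = "\<lambda>p :: cmc_data. \<epsilon> * snd (snd p)"
    fix p assume "p \<in> F"
    show "(\<exists>x\<in>{0<..<1}. p = (q * x, k, \<epsilon> * g x) \<and> ?v p = g x \<and> ?v p < \<epsilon> * s \<and> \<epsilon> * h < ?v p) \<or>
        (\<exists>x\<in>{0<..<1}. p = (- q * x, k, - (\<epsilon> * g' x)) \<and> ?v p = - g' x \<and> \<epsilon> * s < ?v p \<and> ?v p < \<epsilon> * h') \<or>
        p = S \<and> ?v p = \<epsilon> * s \<or> p = (q, k, h) \<and> ?v p = \<epsilon> * h \<or> p = (q', k', h') \<and> ?v p = \<epsilon> * h'"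
      using Fcases[OF \<open>p \<in> F\<close>]
    proof (elim disjE bexE conjE)
      fix x assume x: "x \<in> {0<..<1}" and p: "p = (q * x, k, \<epsilon> * g x)" "?v p = g x"
      have "?v p < \<epsilon> * s" "\<epsilon> * h < ?v p" using gb[OF x] p(2) by linarith+
      with x p show ?thesis by blast
    next
      fix x assume x: "x \<in> {0<..<1}" and p: "p = (- q * x, k, - (\<epsilon> * g' x))" "?v p = - g' x"
      have "\<epsilon> * s < ?v p" "?v p < \<epsilon> * h'" using gb[OF x] p(2) by linarith+
      with x p show ?thesis by blast
    next
      assume p: "p = S"
      then have "?v p = \<epsilon> * s" using S(1) by simp
      with p show ?thesis by blast
    next
      assume p: "p = (q, k, h)"
      then have "?v p = \<epsilon> * h" by simp
      with p show ?thesis by blast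
    next
      assume p: "p = (q', k', h')"
      then have "?v p = \<epsilon> * h'" by simp
      with p show ?thesis by blast
    qed
  qed
  then have inj: "inj_on (\<lambda>p. snd (snd p)) F"
    by (auto simp: inj_on_def)
  have h2: "h\<^sup>2 < 1" "h'\<^sup>2 < 1" using flat_torusD(2)[OF P] flat_torusD(2)[OF P'] .
  have h1: "z\<^sup>2 < 1" if "(x, y, z) \<in> F" for x y z
  proof -
    have "(\<epsilon> * g x)\<^sup>2 < 1" "(- (\<epsilon> * g' x))\<^sup>2 < 1" if "x \<in> {0<..<1}" for x
      using g g' that \<epsilon> unfolding graph_solution_def by auto
    then show ?thesis using that h2 S unfolding F C C' by auto
  qed
  \<comment> \<open>At rotational ends \<open>q * k\<close> is a sign while h lies strictly between
    -1 and 1, so the factor \<open>h - q * k\<close> has a known sign.\<close>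
  have "\<epsilon> * h < 1" "- 1 < \<epsilon> * h'" using h2 \<epsilon> by (auto simp: abs_square_less_1)
  moreover have "h * (h - q * k) = \<epsilon> * h * (\<epsilon> * h - 1)" "h' * (h' - q' * k') = \<epsilon> * h' * (\<epsilon> * h' + 1)"
    unfolding q' eqs mult_minus_left \<epsilon>_def[symmetric] using \<epsilon> by auto
  ultimately have cond: "0 \<le> h * (h - q * k) \<longleftrightarrow> \<epsilon> * h \<le> 0" "0 \<le> h' * (h' - q' * k') \<longleftrightarrow> 0 \<le> \<epsilon> * h'"
    using zero_le_mult_sign(2)[of "\<epsilon> * h - 1" "\<epsilon> * h"] zero_le_mult_sign(1)[of "\<epsilon> * h' + 1" "\<epsilon> * h'"]
    by linarith+
  note cont = graph_solution_continuous[OF g] graph_solution_continuous[OF g']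
  note ends = lower_endD(1,2)[OF lower_end_Ioo] upper_endD(1,2)[OF upper_end_Ioo]
  show "\<exists>!p. p \<in> F \<and> minimal p" if "0 \<le> h * (h - q * k)" "0 \<le> h' * (h' - q' * k')"
  proof -
    have "\<epsilon> * h \<le> 0" "0 \<le> \<epsilon> * h'" using that cond by blast+
    \<comment> \<open>A zero of h is found at the bouquet, at a flat end, or inside the arc on which
      the sign changes.\<close>
    then consider "s = 0" | "h = 0" | "h' = 0" | "\<epsilon> * h < 0" "0 < \<epsilon> * s" | "\<epsilon> * s < 0" "0 < \<epsilon> * h'"
      using \<epsilon> by force
    then have "\<exists>x y. (x, y, 0) \<in> F"
    proof cases
      case 4
      obtain x where "x \<in> {0<..<1}" "g x = 0"
        using IVT_limits[OF _ cont(1) ends(3,4) _ 4(1) ends(1,2) _ 4(2)] g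
        unfolding graph_solution_def by auto
      then have "(q * x, k, 0) \<in> F" unfolding F C by force
      then show ?thesis by blast
    next
      case 5
      have "- (\<epsilon> * h') < 0" "0 < - (\<epsilon> * s)" using 5 by simp_all
      then obtain x where "x \<in> {0<..<1}" "g' x = 0"
        using IVT_limits[OF connected_Ioo cont(2) ends(3,4) _ _ ends(1,2)] g'
        unfolding graph_solution_def by blast
      then have "(- q * x, k, 0) \<in> F" unfolding F C' by force
      then show ?thesis by blast
    qed (auto simp: F S)
    from ex1_minimal[OF inj _ this] show ?thesis using h1 by blast
  qed
  have zero: "snd (snd p) = 0" if "p \<in> F" "minimal p" for p
    using that h1 minimal_iff by (metis prod.collapse)
  show "0 \<le> h * (h - q * k) \<and> 0 \<le> h' * (h' - q' * k')" if "p \<in> F" "minimal p"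
  proof -
    have v: "\<epsilon> * snd (snd p) = 0" using zero[OF that] by simp
    from Fcases[OF that(1)] have "\<epsilon> * h \<le> \<epsilon> * snd (snd p) \<and> \<epsilon> * snd (snd p) \<le> \<epsilon> * h'"
    proof (elim disjE bexE conjE)
      fix x assume x: "x \<in> {0<..<1}" and "\<epsilon> * snd (snd p) = g x"
      then show ?thesis using gb(1,2)[OF x] hs by linarith
    next
      fix x assume x: "x \<in> {0<..<1}" and "\<epsilon> * snd (snd p) = - g' x"
      then show ?thesis using gb(3,4)[OF x] hs by linarith
    qed (use hs S(1) in simp_all)
    then show ?thesis unfolding cond v .
  qed
  show "q' = - q \<and> k' = k \<and> h' = - h \<and> k\<^sup>2 = 1" if "p \<in> F" "minimal p" "\<not> cmc_torus p"
  proof -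
    have "p = S"
      using that tori tori' flat_torusD(3)[OF P] flat_torusD(3)[OF P'] unfolding F by blast
    then have "s = 0" using zero[OF that(1,2)] S(1) by simp
    \<comment> \<open>With \<open>s = 0\<close> both arcs start from the value 0 of the same
      equation, so their limits at 1 agree.\<close>
    then have "\<epsilon> * h = - (\<epsilon> * h')"
      using g g' graph_solution_unique by simp
    then show ?thesis using \<epsilon> q' eqs(1) k2 by auto
  qed
qed

text \<open>The bouquet belongs to the family but has q = 0 and so is no \<open>cmc_torus\<close>.
  If it is the minimal member, the symmetry of the two arcs forces the triple (1, 0, 2), so for
  every other triple uniqueness also holds among tori proper.\<close>

theorem lemma5p8:
  fixes F :: "cmc_data set" and P P' :: cmc_data and l0 l1 l2 :: int
  assumes "flow_family F P P'"
    and "flat_triple P (l0, l1, l2)"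
    and "flat_triple P' (l1 + l2 - l0, l1, l2)"
    and "0 \<le> l1" and "l1 < l0" and "l0 < l2"
  shows "if sqrt (real_of_int (l1\<^sup>2 + l2\<^sup>2)) \<ge> sqrt 2 * real_of_int (max l0 (l1 + l2 - l0))
         then (\<exists>!p. p \<in> F \<and> minimal p) \<and>
              ((l0, l1, l2) \<noteq> (1, 0, 2) \<longrightarrow> (\<exists>!p. p \<in> F \<and> cmc_torus p \<and> minimal p))
         else \<not> (\<exists>p\<in>F. minimal p)"
proof -
  obtain q k h q' k' h' where P: "P = (q, k, h)" "P' = (q', k', h')" by (cases P, cases P')
  note t = assms(2)[unfolded P] and t' = assms(3)[unfolded P]
  have pos: "0 < l0" "0 < l1 + l2 - l0" using assms(4-) by linarith+
  then have nz: "l0 \<noteq> 0" "l1 + l2 - l0 \<noteq> 0" "l1 \<noteq> l2" using assms(4-) by linarith+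
  note c = flat_triple_condition[OF t nz(1,3)] and c' = flat_triple_condition[OF t' nz(2,3)]
  have cond: "sqrt 2 * real_of_int (max l0 (l1 + l2 - l0)) \<le> sqrt (real_of_int (l1\<^sup>2 + l2\<^sup>2)) \<longleftrightarrow>
      0 \<le> h * (h - q * k) \<and> 0 \<le> h' * (h' - q' * k')"
    unfolding sqrt_condition[OF pos] c(2) c'(2) ..
  have fam: "nonrotational_flow_family F (q, k, h) (q', k', h') \<or> rotational_flow_family F (q, k, h) (q', k', h')"
    using assms(1) unfolding flow_family_def P .
  have ex1: "\<exists>!p. p \<in> F \<and> minimal p" if "0 \<le> h * (h - q * k) \<and> 0 \<le> h' * (h' - q' * k')"
    using fam that nonrotational_family_minimal(2)[OF _ c(1) c'(1)] rotational_family_minimal(1) by blast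
  have none: "0 \<le> h * (h - q * k) \<and> 0 \<le> h' * (h' - q' * k')" if "p \<in> F" "minimal p" for p
    using fam
  proof
    assume "nonrotational_flow_family F (q, k, h) (q', k', h')"
    from nonrotational_family_minimal(3)[OF this c(1) c'(1) that] show ?thesis .
  next
    assume "rotational_flow_family F (q, k, h) (q', k', h')"
    from rotational_family_minimal(2)[OF this that] show ?thesis .
  qed
  have torus: "cmc_torus p" if p: "p \<in> F" "minimal p" and l: "(l0, l1, l2) \<noteq> (1, 0, 2)" for p
    using fam
  proof
    assume "nonrotational_flow_family F (q, k, h) (q', k', h')"
    from nonrotational_family_minimal(1)[OF this c(1) c'(1) p(1)] show ?thesis .
  next
    assume rot: "rotational_flow_family F (q, k, h) (q', k', h')"
    show ?thesis
    proof (rule ccontr)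
      assume "\<not> cmc_torus p"
      from rotational_family_minimal(3)[OF rot p this]
      have "q' = - q" "k' = k" "h' = - h" "k\<^sup>2 = 1" by blast+
      with triple_of_symmetric_ends[OF t] t' assms(4-) l show False by blast
    qed
  qed
  show ?thesis
  proof (cases "0 \<le> h * (h - q * k) \<and> 0 \<le> h' * (h' - q' * k')")
    case True
    have "\<exists>!p. p \<in> F \<and> cmc_torus p \<and> minimal p" if "(l0, l1, l2) \<noteq> (1, 0, 2)"
    proof -
      have "(\<lambda>p. p \<in> F \<and> cmc_torus p \<and> minimal p) = (\<lambda>p. p \<in> F \<and> minimal p)"
        using torus[OF _ _ that] by blast
      then show ?thesis using ex1[OF True] by (simp only:)
    qed
    then show ?thesis unfolding cond if_P[OF True] using ex1[OF True] by blast
  next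
    case False
    then show ?thesis unfolding cond if_not_P[OF False] using none by blast
  qed
qed

end
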